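(* Let $\theta,\alpha$ be nonconstant inner functions. Then the space $\mathcal{T}(K_\theta^\perp,K_\alpha^\perp)$ of asymmetric dual truncated Toeplitz operators is weak*-closed (and WOT-closed) in $\mathcal{B}(K_\theta^\perp,K_\alpha^\perp)$ and $2$-reflexive.
   Context: $L^2=L^2(\mathbb{T},m)$ with $m$ normalized Lebesgue measure on the unit circle; $H^2\subset L^2$ is the Hardy space. For an inner function $\theta$, $K_\theta=H^2\ominus\theta H^2$ and $K_\theta^\perp=L^2\ominus K_\theta=\theta H^2\oplus\overline{zH^2}$; $P_\theta^\perp$ is the orthogonal projection of $L^2$ onto $K_\theta^\perp$. For $\varphi\in L^2$, $D^{\theta,\alpha}_\varphi$ is defined on $K_\theta^\perp\cap L^\infty$ (dense in $K_\theta^\perp$) by $D^{\theta,\alpha}_\varphi f=P_\alpha^\perp(\varphi f)$. If it extends to a bounded operator $K_\theta^\perp\to K_\alpha^\perp$ (this happens if and only if $\varphi\in L^\infty$), it is called an asymmetric dual truncated Toeplitz operator; $\mathcal{T}(K_\theta^\perp,K_\alpha^\perp)\subset\mathcal{B}(K_\theta^\perp,K_\alpha^\perp)$ is the set of all such bounded operators. For separable complex Hilbert spaces $\mathcal{H},\mathcal{K}$, $\mathcal{B}(\mathcal{H},\mathcal{K})$ is the space of bounded linear operators $\mathcal{H}\to\mathcal{K}$ and $\mathcal{B}_1(\mathcal{K},\mathcal{H})$ the space of trace class operators $\mathcal{K}\to\mathcal{H}$; $f\otimes g$ ($f\in\mathcal{H}$, $g\in\mathcal{K}$) is the operator $x\mapsto\langle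 x,g\rangle f$. $\mathcal{B}(\mathcal{H},\mathcal{K})$ is the dual of $\mathcal{B}_1(\mathcal{K},\mathcal{H})$ via $<T,t>=\sum_n\langle Tf_n,g_n\rangle$ for $t=\sum_n f_n\otimes g_n$ with $\sum\|f_n\|^2<\infty$, $\sum\|g_n\|^2<\infty$; this gives the weak* topology. WOT is the weak operator topology. $\mathcal{F}_k$ is the set of operators in $\mathcal{B}_1(\mathcal{K},\mathcal{H})$ of rank at most $k$. For $\mathcal{S}\subset\mathcal{B}(\mathcal{H},\mathcal{K})$, $\mathcal{S}_\perp=\{t\in\mathcal{B}_1(\mathcal{K},\mathcal{H}):<T,t>=0\ \forall T\in\mathcal{S}\}$; for $\mathcal{M}\subset\mathcal{B}_1(\mathcal{K},\mathcal{H})$, $\mathcal{M}^\perp=\{T\in\mathcal{B}(\mathcal{H},\mathcal{K}):<T,t>=0\ \forall t\in\mathcal{M}\}$. A weak*-closed subspace $\mathcal{S}$ is $k$-reflexive ($k\ge2$) if $\mathcal{S}=(\mathcal{S}_\perp\cap\mathcal{F}_k)^\perp$. *)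

theory Defs
  imports "HOL-Analysis.Analysis" "HOL-Probability.Probability_Measure"
begin

section \<open>Complex inner product spaces\<close>

class complex_inner = real_inner +
  fixes scaleC :: "complex \<Rightarrow> 'a \<Rightarrow> 'a"  (infixr \<open>*\<^sub>C\<close> 75)
    and cinner :: "'a \<Rightarrow> 'a \<Rightarrow> complex"
  assumes scaleC_add_right: "a *\<^sub>C (x + y) = a *\<^sub>C x + a *\<^sub>C y"
    and scaleC_add_left: "(a + b) *\<^sub>C x = a *\<^sub>C x + b *\<^sub>C x"
    and scaleC_scaleC: "a *\<^sub>C (b *\<^sub>C x) = (a * b) *\<^sub>C x"
    and scaleR_scaleC: "r *\<^sub>R x = complex_of_real r *\<^sub>C x"
    and cinner_commute: "cinner x y = cnj (cinner y x)"
    and cinner_add_left: "cinner (x + y) z = cinner x z + cinner y z"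
    and cinner_scaleC_left: "cinner (a *\<^sub>C x) y = a * cinner x y"
    and inner_eq_Re_cinner: "inner x y = Re (cinner x y)"

global_interpretation complex_vector:
  vector_space "scaleC :: complex \<Rightarrow> 'a \<Rightarrow> 'a::complex_inner"
proof
  fix x :: 'a
  show "1 *\<^sub>C x = x"
    using scaleR_scaleC[of 1 x] by simp
qed (fact scaleC_add_right scaleC_add_left scaleC_scaleC)+

definition ortho_complement :: "'a::complex_inner set \<Rightarrow> 'a set" where
  "ortho_complement M = {x. \<forall>y\<in>M. cinner x y = 0}"

text \<open>Meaningful when \<open>M\<close> is a closed subspace of a complete space.\<close>
definition ortho_proj :: "'a::complex_inner set \<Rightarrow> 'a \<Rightarrow> 'a" where
  "ortho_proj M x = (THE y. y \<in> M \<and> x - y \<in> ortho_complement M)"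


section \<open>Operators between subspaces, trace class and duality\<close>

text \<open>
  The Hilbert spaces below are closed complex subspaces \<open>H\<close>, \<open>K\<close> of ambient spaces. An operator
  \<open>H \<rightarrow> K\<close> is a function that is \<open>undefined\<close> outside \<open>H\<close>, so that equality of operators is
  equality on \<open>H\<close>.
\<close>

definition bounded_ops :: "'a::complex_inner set \<Rightarrow> 'b::complex_inner set \<Rightarrow> ('a \<Rightarrow> 'b) set" where
  "bounded_ops H K = {T \<in> H \<rightarrow>\<^sub>E K.
     (\<forall>x\<in>H. \<forall>y\<in>H. T (x + y) = T x + T y) \<and>
     (\<forall>c. \<forall>x\<in>H. T (c *\<^sub>C x) = c *\<^sub>C T x) \<and>
     (\<exists>C. \<forall>x\<in>H. norm (T x) \<le> C * norm x)}"

text \<open>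
  \<open>nuclear_rep K H t f g\<close> says \<open>t = (\<Sum>n. f\<^sub>n \<otimes> g\<^sub>n)\<close> as an operator \<open>K \<rightarrow> H\<close>, where
  \<open>(f \<otimes> g) x = \<langle>x, g\<rangle> f\<close>. The square summability makes the series absolutely convergent.
\<close>
definition nuclear_rep ::
  "'b::complex_inner set \<Rightarrow> 'a::complex_inner set \<Rightarrow> ('b \<Rightarrow> 'a) \<Rightarrow> (nat \<Rightarrow> 'a) \<Rightarrow> (nat \<Rightarrow> 'b) \<Rightarrow> bool" where
  "nuclear_rep K H t f g \<longleftrightarrow>
     range f \<subseteq> H \<and> range g \<subseteq> K \<and>
     summable (\<lambda>n. (norm (f n))\<^sup>2) \<and> summable (\<lambda>n. (norm (g n))\<^sup>2) \<and>
     t \<in> K \<rightarrow>\<^sub>E H \<and> (\<forall>x\<in>K. (\<lambda>n. cinner x (g n) *\<^sub>C f n) sums t x)"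

definition trace_class :: "'b::complex_inner set \<Rightarrow> 'a::complex_inner set \<Rightarrow> ('b \<Rightarrow> 'a) set" where
  "trace_class K H = {t. \<exists>f g. nuclear_rep K H t f g}"

text \<open>
  The value \<open><T, t> = (\<Sum>n. \<langle>T f\<^sub>n, g\<^sub>n\<rangle>)\<close> is the trace of \<open>T \<circ> t\<close>; it does not depend on
  the representation of \<open>t\<close>.
\<close>
definition pairing ::
  "'a::complex_inner set \<Rightarrow> 'b::complex_inner set \<Rightarrow> ('a \<Rightarrow> 'b) \<Rightarrow> ('b \<Rightarrow> 'a) \<Rightarrow> complex" where
  "pairing H K T t =
     (THE c. \<exists>f g. nuclear_rep K H t f g \<and> (\<lambda>n. cinner (T (f n)) (g n)) sums c)"

text \<open>The coarsest topology on bounded operators making all \<open>T \<mapsto> <T, t>\<close> continuous.\<close>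
definition weak_star_topology ::
  "'a::complex_inner set \<Rightarrow> 'b::complex_inner set \<Rightarrow> ('a \<Rightarrow> 'b) topology" where
  "weak_star_topology H K =
     pullback_topology (bounded_ops H K) (\<lambda>T. \<lambda>t\<in>trace_class K H. pairing H K T t)
       (product_topology (\<lambda>_. euclidean) (trace_class K H))"

text \<open>The coarsest topology on bounded operators making all \<open>T \<mapsto> \<langle>T x, y\<rangle>\<close> continuous.\<close>
definition weak_operator_topology ::
  "'a::complex_inner set \<Rightarrow> 'b::complex_inner set \<Rightarrow> ('a \<Rightarrow> 'b) topology" where
  "weak_operator_topology H K =
     pullback_topology (bounded_ops H K) (\<lambda>T. \<lambda>(x, y)\<in>H \<times> K. cinner (T x) y)
       (product_topology (\<lambda>_. euclidean) (H \<times> K))"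

definition finite_rank ::
  "nat \<Rightarrow> 'b::complex_inner set \<Rightarrow> 'a::complex_inner set \<Rightarrow> ('b \<Rightarrow> 'a) set" where
  "finite_rank k K H =
     {t \<in> trace_class K H. \<exists>B. finite B \<and> card B \<le> k \<and> t ` K \<subseteq> complex_vector.span B}"

definition preannihilator ::
  "'a::complex_inner set \<Rightarrow> 'b::complex_inner set \<Rightarrow> ('a \<Rightarrow> 'b) set \<Rightarrow> ('b \<Rightarrow> 'a) set" where
  "preannihilator H K S = {t \<in> trace_class K H. \<forall>T\<in>S. pairing H K T t = 0}"

definition annihilator ::
  "'a::complex_inner set \<Rightarrow> 'b::complex_inner set \<Rightarrow> ('b \<Rightarrow> 'a) set \<Rightarrow> ('a \<Rightarrow> 'b) set" where
  "annihilator H K M = {T \<in> bounded_ops H K. \<forall>t\<in>M. pairing H K T t = 0}"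

definition op_subspace ::
  "'a::complex_inner set \<Rightarrow> 'b::complex_inner set \<Rightarrow> ('a \<Rightarrow> 'b) set \<Rightarrow> bool" where
  "op_subspace H K S \<longleftrightarrow> S \<subseteq> bounded_ops H K \<and> (\<lambda>x\<in>H. 0) \<in> S \<and>
     (\<forall>T\<in>S. \<forall>U\<in>S. (\<lambda>x\<in>H. T x + U x) \<in> S) \<and>
     (\<forall>c. \<forall>T\<in>S. (\<lambda>x\<in>H. c *\<^sub>C T x) \<in> S)"

definition k_reflexive ::
  "nat \<Rightarrow> 'a::complex_inner set \<Rightarrow> 'b::complex_inner set \<Rightarrow> ('a \<Rightarrow> 'b) set \<Rightarrow> bool" where
  "k_reflexive k H K S \<longleftrightarrow>
     op_subspace H K S \<and> closedin (weak_star_topology H K) S \<and>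
     S = annihilator H K (preannihilator H K S \<inter> finite_rank k K H)"


section \<open>The space \<open>L\<^sup>2\<close> of the unit circle\<close>

text \<open>
  Normalized Lebesgue measure on the unit circle, as a Borel measure on the complex plane
  concentrated on the circle.
\<close>
definition circle_measure :: "complex measure" where
  "circle_measure = distr (uniform_measure lborel {0..<2 * pi}) borel cis"

lemma prob_space_circle_measure: "prob_space circle_measure"
proof -
  have "cis \<in> borel_measurable borel"
    by (intro borel_measurable_continuous_onI continuous_intros)
  then have "cis \<in> borel_measurable (uniform_measure lborel {0..<2 * pi})"
    by (simp add: measurable_def)
  then show ?thesis
    unfolding circle_measure_def
    by (intro prob_space.prob_space_distr prob_space_uniform_measure) auto
qed

definition square_integrable :: "(complex \<Rightarrow> complex) \<Rightarrow> bool" where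
  "square_integrable f \<longleftrightarrow>
     f \<in> borel_measurable circle_measure \<and> integrable circle_measure (\<lambda>z. (norm (f z))\<^sup>2)"

lemma square_integrable_zero: "square_integrable (\<lambda>_. 0)"
  by (simp add: square_integrable_def)

lemma square_integrable_scale:
  assumes "square_integrable f" shows "square_integrable (\<lambda>z. c * f z)"
  using assms by (auto simp: square_integrable_def norm_mult power_mult_distrib)

lemma square_integrable_add:
  assumes "square_integrable f" "square_integrable g"
  shows "square_integrable (\<lambda>z. f z + g z)"
proof -
  have [measurable]: "f \<in> borel_measurable circle_measure" "g \<in> borel_measurable circle_measure"
    using assms by (auto simp: square_integrable_def)
  have "integrable circle_measure (\<lambda>z. 2 * (norm (f z))\<^sup>2 + 2 * (norm (g z))\<^sup>2)"
    using assms by (auto simp: square_integrable_def)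
  moreover have "(norm (a + b))\<^sup>2 \<le> 2 * (norm a)\<^sup>2 + 2 * (norm b)\<^sup>2" for a b :: complex
  proof -
    have "(norm (a + b))\<^sup>2 \<le> (norm a + norm b)\<^sup>2"
      by (intro power_mono norm_triangle_ineq) auto
    also have "\<dots> \<le> 2 * (norm a)\<^sup>2 + 2 * (norm b)\<^sup>2"
      using zero_le_power2[of "norm a - norm b"]
      unfolding power2_eq_square by (simp add: algebra_simps)
    finally show ?thesis .
  qed
  ultimately have "integrable circle_measure (\<lambda>z. (norm (f z + g z))\<^sup>2)"
    by (elim Bochner_Integration.integrable_bound) auto
  then show ?thesis by (simp add: square_integrable_def)
qed

lemma square_integrable_mult:
  assumes "square_integrable f" "square_integrable g"
  shows "integrable circle_measure (\<lambda>z. f z * cnj (g z))"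
proof -
  have [measurable]: "f \<in> borel_measurable circle_measure" "g \<in> borel_measurable circle_measure"
    using assms by (auto simp: square_integrable_def)
  have cnj_meas: "cnj \<in> borel_measurable borel"
    by (intro borel_measurable_continuous_onI continuous_intros)
  have [measurable]: "(\<lambda>z. cnj (g z)) \<in> borel_measurable circle_measure"
    by (rule measurable_compose[OF _ cnj_meas]) measurable
  have "integrable circle_measure (\<lambda>z. (norm (f z))\<^sup>2 + (norm (g z))\<^sup>2)"
    using assms by (auto simp: square_integrable_def)
  moreover have "norm (a * cnj b) \<le> (norm a)\<^sup>2 + (norm b)\<^sup>2" for a b :: complex
  proof -
    have "2 * (norm a * norm b) \<le> (norm a)\<^sup>2 + (norm b)\<^sup>2"
      using sum_squares_bound[of "norm a" "norm b"] by simp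
    moreover have "0 \<le> norm a * norm b" by simp
    ultimately show ?thesis unfolding norm_mult complex_mod_cnj by linarith
  qed
  ultimately show ?thesis
    by (elim Bochner_Integration.integrable_bound) auto
qed

quotient_type L2 = "complex \<Rightarrow> complex" / partial:
  "\<lambda>f g. square_integrable f \<and> square_integrable g \<and> (AE z in circle_measure. f z = g z)"
proof (rule part_equivpI)
  show "\<exists>f. square_integrable f \<and> square_integrable f \<and> (AE z in circle_measure. f z = f z)"
    using square_integrable_zero by auto
qed (auto intro!: sympI transpI)

instantiation L2 :: complex_inner
begin

lift_definition zero_L2 :: L2 is "\<lambda>_. 0"
  by (simp add: square_integrable_zero)

lift_definition plus_L2 :: "L2 \<Rightarrow> L2 \<Rightarrow> L2" is "\<lambda>f g z. f z + g z"
  by (auto intro: square_integrable_add)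

lift_definition scaleC_L2 :: "complex \<Rightarrow> L2 \<Rightarrow> L2" is "\<lambda>c f z. c * f z"
  by (auto intro: square_integrable_scale)

lift_definition cinner_L2 :: "L2 \<Rightarrow> L2 \<Rightarrow> complex"
  is "\<lambda>f g. LINT z|circle_measure. f z * cnj (g z)"
proof -
  fix f f' g g' :: "complex \<Rightarrow> complex"
  assume *: "square_integrable f \<and> square_integrable f' \<and> (AE z in circle_measure. f z = f' z)"
    "square_integrable g \<and> square_integrable g' \<and> (AE z in circle_measure. g z = g' z)"
  show "(LINT z|circle_measure. f z * cnj (g z)) = (LINT z|circle_measure. f' z * cnj (g' z))"
    using * square_integrable_mult[of f g] square_integrable_mult[of f' g']
    by (intro integral_cong_AE) (auto dest: borel_measurable_integrable)
qed

definition scaleR_L2 :: "real \<Rightarrow> L2 \<Rightarrow> L2" where "scaleR_L2 r f = complex_of_real r *\<^sub>C f"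
definition uminus_L2 :: "L2 \<Rightarrow> L2" where "uminus_L2 f = (-1) *\<^sub>C f"
definition minus_L2 :: "L2 \<Rightarrow> L2 \<Rightarrow> L2" where "minus_L2 f g = f + - g"
definition inner_L2 :: "L2 \<Rightarrow> L2 \<Rightarrow> real" where "inner_L2 f g = Re (cinner f g)"
definition norm_L2 :: "L2 \<Rightarrow> real" where "norm_L2 f = sqrt (inner f f)"
definition sgn_L2 :: "L2 \<Rightarrow> L2" where "sgn_L2 f = inverse (norm f) *\<^sub>R f"
definition dist_L2 :: "L2 \<Rightarrow> L2 \<Rightarrow> real" where "dist_L2 f g = norm (f - g)"
definition uniformity_L2 :: "(L2 \<times> L2) filter" where
  "uniformity_L2 = (INF e\<in>{0<..}. principal {(x, y). dist x y < e})"
definition open_L2 :: "L2 set \<Rightarrow> bool" where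
  "open_L2 U \<longleftrightarrow> (\<forall>x\<in>U. \<forall>\<^sub>F (x', y) in uniformity. x' = x \<longrightarrow> y \<in> U)"

instance
proof
  fix f g h :: L2 and a b :: complex and r s :: real
  have C1: "a *\<^sub>C (f + g) = a *\<^sub>C f + a *\<^sub>C g" for a :: complex and f g :: L2
    by transfer (auto simp: algebra_simps intro!: square_integrable_add square_integrable_scale)
  have C2: "(a + b) *\<^sub>C f = a *\<^sub>C f + b *\<^sub>C f" for a b :: complex and f :: L2
    by transfer (auto simp: algebra_simps square_integrable_scale
        intro!: square_integrable_add square_integrable_scale)
  have C3: "a *\<^sub>C (b *\<^sub>C f) = (a * b) *\<^sub>C f" for a b :: complex and f :: L2
    by transfer (auto simp: algebra_simps intro!: square_integrable_scale)
  have C4: "1 *\<^sub>C f = f" for f :: L2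
    by transfer auto
  have C0: "0 *\<^sub>C f = 0" for f :: L2
    by transfer (auto simp: square_integrable_zero)
  have A1: "f + g + h = f + (g + h)" for f g h :: L2
    by transfer (auto simp: algebra_simps intro!: square_integrable_add)
  have A2: "f + g = g + f" for f g :: L2
    by transfer (auto simp: algebra_simps intro!: square_integrable_add)
  have A3: "0 + f = f" for f :: L2
    by transfer auto
  show "f + g + h = f + (g + h)" "f + g = g + f" "0 + f = f" by (fact A1 A2 A3)+
  show "- f + f = 0"
    using C2[of "-1" 1 f] by (simp add: uminus_L2_def C4 C0)
  show "f - g = f + - g" by (simp add: minus_L2_def)
  show "r *\<^sub>R f = complex_of_real r *\<^sub>C f" by (simp add: scaleR_L2_def)
  show "a *\<^sub>C (f + g) = a *\<^sub>C f + a *\<^sub>C g" "(a + b) *\<^sub>C f = a *\<^sub>C f + b *\<^sub>C f"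
    "a *\<^sub>C (b *\<^sub>C f) = (a * b) *\<^sub>C f" by (fact C1 C2 C3)+
  show "r *\<^sub>R (f + g) = r *\<^sub>R f + r *\<^sub>R g" "(r + s) *\<^sub>R f = r *\<^sub>R f + s *\<^sub>R f"
    "r *\<^sub>R (s *\<^sub>R f) = (r * s) *\<^sub>R f" "1 *\<^sub>R f = f"
    by (simp_all add: scaleR_L2_def C1 C2 C3 C4)
  have I1: "cinner f g = cnj (cinner g f)" for f g :: L2
  proof transfer
    fix f g :: "complex \<Rightarrow> complex"
    have "(LINT z|circle_measure. f z * cnj (g z)) = (LINT z|circle_measure. cnj (g z * cnj (f z)))"
      by (simp add: mult.commute)
    also have "\<dots> = cnj (LINT z|circle_measure. g z * cnj (f z))"
      by (rule Bochner_Integration.integral_cnj)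
    finally show "(LINT z|circle_measure. f z * cnj (g z)) =
      cnj (LINT z|circle_measure. g z * cnj (f z))" .
  qed
  have I2: "cinner (f + g) h = cinner f h + cinner g h" for f g h :: L2
  proof transfer
    fix f g h :: "complex \<Rightarrow> complex"
    assume "square_integrable f \<and> square_integrable f \<and> (AE z in circle_measure. f z = f z)"
      "square_integrable g \<and> square_integrable g \<and> (AE z in circle_measure. g z = g z)"
      "square_integrable h \<and> square_integrable h \<and> (AE z in circle_measure. h z = h z)"
    then show "(LINT z|circle_measure. (f z + g z) * cnj (h z)) =
      (LINT z|circle_measure. f z * cnj (h z)) + (LINT z|circle_measure. g z * cnj (h z))"
      by (simp add: distrib_right square_integrable_mult)
  qed
  have I3: "cinner (a *\<^sub>C f) g = a * cinner f g" for a :: complex and f g :: L2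
    by transfer (simp add: mult.assoc)
  show "cinner f g = cnj (cinner g f)" "cinner (f + g) h = cinner f h + cinner g h"
    "cinner (a *\<^sub>C f) g = a * cinner f g" by (fact I1 I2 I3)+
  show "inner f g = Re (cinner f g)" by (simp add: inner_L2_def)
  show "inner f g = inner g f"
    using arg_cong[OF I1[of f g], of Re] by (simp add: inner_L2_def)
  show "inner (f + g) h = inner f h + inner g h" "inner (r *\<^sub>R f) g = r * inner f g"
    by (simp_all add: inner_L2_def scaleR_L2_def I2 I3)
  have sq: "inner f f = (LINT z|circle_measure. (norm (rep_L2 f z))\<^sup>2)" for f
  proof -
    have "(LINT z|circle_measure. rep_L2 f z * cnj (rep_L2 f z)) =
        (LINT z|circle_measure. complex_of_real ((norm (rep_L2 f z))\<^sup>2))"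
      by (intro Bochner_Integration.integral_cong refl) (rule complex_norm_square[symmetric])
    then show ?thesis
      by (simp only: inner_L2_def cinner_L2.rep_eq integral_complex_of_real Re_complex_of_real)
  qed
  show "0 \<le> inner f f" by (simp add: sq)
  have "f = 0" if "inner f f = 0"
  proof -
    have si: "square_integrable (rep_L2 f)"
      using Quotient3_rep_reflp[OF Quotient3_L2] by blast
    then have "AE z in circle_measure. (norm (rep_L2 f z))\<^sup>2 = 0"
      using that by (subst integral_nonneg_eq_0_iff_AE[symmetric])
        (auto simp: sq square_integrable_def)
    then have "abs_L2 (rep_L2 f) = abs_L2 (\<lambda>_. 0)"
      using si by (intro Quotient3_rel_abs[OF Quotient3_L2]) (auto simp: square_integrable_zero)
    then show ?thesis
      using Quotient3_abs_rep[OF Quotient3_L2] by (simp add: zero_L2_def)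
  qed
  moreover have "inner (0::L2) 0 = 0"
    by (simp add: inner_L2_def zero_L2.transfer) (transfer, simp)
  ultimately show "inner f f = 0 \<longleftrightarrow> f = 0" by blast
  show "norm f = sqrt (inner f f)" by (simp add: norm_L2_def)
  show "dist f g = norm (f - g)" by (simp add: dist_L2_def)
  show "sgn f = inverse (norm f) *\<^sub>R f" by (simp add: sgn_L2_def)
  show "(uniformity :: (L2 \<times> L2) filter) = (INF e\<in>{0<..}. principal {(x, y). dist x y < e})"
    by (simp add: uniformity_L2_def)
  show "open U \<longleftrightarrow> (\<forall>x\<in>U. \<forall>\<^sub>F (x', y) in uniformity. x' = x \<longrightarrow> y \<in> U)" for U :: "L2 set"
    by (simp add: open_L2_def)
qed

end

text \<open>
  Pointwise product. It is only ever used when one factor is essentially bounded, so that the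
  product is square integrable; the value 0 in the remaining case is a dummy.
\<close>
lift_definition mult_L2 :: "L2 \<Rightarrow> L2 \<Rightarrow> L2"
  is "\<lambda>f g. if square_integrable (\<lambda>z. f z * g z) then (\<lambda>z. f z * g z) else (\<lambda>_. 0)"
proof -
  fix f f' g g' :: "complex \<Rightarrow> complex"
  assume *: "square_integrable f \<and> square_integrable f' \<and> (AE z in circle_measure. f z = f' z)"
    "square_integrable g \<and> square_integrable g' \<and> (AE z in circle_measure. g z = g' z)"
  have [measurable]: "f \<in> borel_measurable circle_measure" "g \<in> borel_measurable circle_measure"
    "f' \<in> borel_measurable circle_measure" "g' \<in> borel_measurable circle_measure"
    using * by (auto simp: square_integrable_def)
  have ae: "AE z in circle_measure. f z * g z = f' z * g' z"
    using * by auto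
  then have "integrable circle_measure (\<lambda>z. (norm (f z * g z))\<^sup>2) \<longleftrightarrow>
      integrable circle_measure (\<lambda>z. (norm (f' z * g' z))\<^sup>2)"
    by (intro integrable_cong_AE) auto
  then have eq: "square_integrable (\<lambda>z. f z * g z) \<longleftrightarrow> square_integrable (\<lambda>z. f' z * g' z)"
    by (simp add: square_integrable_def)
  let ?p = "\<lambda>f g. if square_integrable (\<lambda>z. f z * g z) then (\<lambda>z. f z * g z) else (\<lambda>_. 0)"
  show "square_integrable (?p f g) \<and> square_integrable (?p f' g') \<and>
      (AE z in circle_measure. ?p f g z = ?p f' g' z)"
    using ae eq by (simp add: square_integrable_zero)
qed

lift_definition ess_bounded :: "L2 \<Rightarrow> bool"
  is "\<lambda>f. \<exists>C. AE z in circle_measure. norm (f z) \<le> C"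
  by (intro ex_cong1 eventually_cong) (auto elim: eventually_mono)

definition Linf :: "L2 set" where
  "Linf = {f. ess_bounded f}"

lift_definition unimodular :: "L2 \<Rightarrow> bool"
  is "\<lambda>f. AE z in circle_measure. norm (f z) = 1"
  by (intro eventually_cong) (auto elim: eventually_mono)

lift_definition nonconstant :: "L2 \<Rightarrow> bool"
  is "\<lambda>f. \<not> (\<exists>c. AE z in circle_measure. f z = c)"
  by (intro arg_cong[where f = Not] ex_cong1 eventually_cong) (auto elim: eventually_mono)

lift_definition fourier_coeff :: "L2 \<Rightarrow> int \<Rightarrow> complex"
  is "\<lambda>f n. LINT z|circle_measure. f z * z powi (- n)"
proof -
  fix f g :: "complex \<Rightarrow> complex"
  assume *: "square_integrable f \<and> square_integrable g \<and> (AE z in circle_measure. f z = g z)"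
  have [measurable]: "(\<lambda>z::complex. z powi (- n)) \<in> borel_measurable circle_measure" for n
    unfolding power_int_def circle_measure_def by simp
  have [measurable]: "f \<in> borel_measurable circle_measure" "g \<in> borel_measurable circle_measure"
    using * by (auto simp: square_integrable_def)
  show "(\<lambda>n. LINT z|circle_measure. f z * z powi (- n)) =
      (\<lambda>n. LINT z|circle_measure. g z * z powi (- n))"
    using * by (intro ext integral_cong_AE) auto
qed


section \<open>Hardy space, model spaces and dual truncated Toeplitz operators\<close>

definition H2 :: "L2 set" where
  "H2 = {f. \<forall>n<0. fourier_coeff f n = 0}"

text \<open>Inner functions are identified with their boundary values on the circle.\<close>
definition inner_function :: "L2 \<Rightarrow> bool" where
  "inner_function \<theta> \<longleftrightarrow> \<theta> \<in> H2 \<inter> Linf \<and> unimodular \<theta>"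

definition model_space :: "L2 \<Rightarrow> L2 set" where
  "model_space \<theta> = H2 \<inter> ortho_complement (mult_L2 \<theta> ` H2)"

definition model_perp :: "L2 \<Rightarrow> L2 set" where
  "model_perp \<theta> = ortho_complement (model_space \<theta>)"

text \<open>
  \<open>P\<^sub>\<alpha>\<^sup>\<bottom> (\<phi> f)\<close>, to be applied to bounded \<open>f\<close> only. The inner function \<open>\<theta>\<close> enters through
  the domain \<open>model_perp \<theta> \<inter> Linf\<close>, on which the symbol \<open>\<phi> \<in> L\<^sup>2\<close> determines the operator.
\<close>
definition dual_TTO :: "L2 \<Rightarrow> L2 \<Rightarrow> L2 \<Rightarrow> L2" where
  "dual_TTO \<alpha> \<phi> f = ortho_proj (model_perp \<alpha>) (mult_L2 \<phi> f)"

definition dual_TTOs :: "L2 \<Rightarrow> L2 \<Rightarrow> (L2 \<Rightarrow> L2) set" where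
  "dual_TTOs \<theta> \<alpha> = {T \<in> bounded_ops (model_perp \<theta>) (model_perp \<alpha>).
     \<exists>\<phi>. \<forall>f \<in> model_perp \<theta> \<inter> Linf. T f = dual_TTO \<alpha> \<phi> f}"

end

theory Submission
  imports Defs
begin

text \<open>
  The operators with a symbol are characterized by equations between matrix entries. If \<open>T\<close> has symbol
  \<open>\<phi>\<close>, then \<open>\<langle>T f, g\<rangle> = \<integral> \<phi> f (cnj g)\<close> for bounded \<open>f\<close>, and so
  \<open>\<langle>T f\<^sub>1, g\<^sub>1\<rangle> = \<langle>T f\<^sub>2, g\<^sub>2\<rangle>\<close> whenever \<open>f\<^sub>1 cnj g\<^sub>1 = f\<^sub>2 cnj g\<^sub>2\<close>. Such an equation says that \<open>T\<close> annihilates the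
  operator \<open>f\<^sub>1 \<otimes> g\<^sub>1 - f\<^sub>2 \<otimes> g\<^sub>2\<close>, whose rank is at most two. Once the equations are known to be sufficient for the
  existence of a symbol (lemma \<open>dual_TTOs_eq_product_equations\<close>), the set of operators with a
  symbol is an annihilator of operators of rank at most two; this gives 2-reflexivity and closedness in
  both topologies (lemma \<open>reflexive_if_rank_two_equations\<close>).

  For sufficiency, consider first the compression of \<open>T\<close> to \<open>cnj (zH\<^sup>2)\<close>, which lies in both
  \<open>K\<^sub>\<theta>\<^sup>\<bottom>\<close> and \<open>K\<^sub>\<alpha>\<^sup>\<bottom>\<close>. The equations make \<open>\<langle>T z\<^sup>n, z\<^sup>m\<rangle>\<close> for \<open>n, m < 0\<close> depend on \<open>m - n\<close> only. One row and one
  column of this Toeplitz matrix are square summable and contain all its entries, so that they are the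
  Fourier coefficients of some \<open>\<phi>\<close> in \<open>L\<^sup>2\<close> (lemma \<open>symbol_exists_negative_powers\<close>). In each
  integral \<open>\<integral> \<phi> f (cnj g)\<close> below, \<open>f\<close> or \<open>g\<close> is bounded, and then the integral is continuous in the
  other function.

  The remaining entries reduce to this block. The space \<open>K\<^sub>\<theta>\<^sup>\<bottom> = \<theta>H\<^sup>2 \<oplus> cnj (zH\<^sup>2)\<close> has the orthonormal basis
  \<open>\<theta>z\<^sup>n\<close> for \<open>n \<ge> 0\<close> and \<open>z\<^sup>n\<close> for \<open>n < 0\<close>, and similarly for \<open>\<alpha>\<close>. The product of a basis vector with the
  conjugate of another is always of the form \<open>h (cnj k)\<close> with \<open>h, k\<close> bounded in \<open>H\<^sup>2\<close>, and
  \<open>h (cnj k) = f (cnj g)\<close> for \<open>f = cnj (zk)\<close> and \<open>g = cnj (zh)\<close>, both in \<open>cnj (zH\<^sup>2)\<close>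
  (lemma \<open>perp_basis_product_equation\<close>). Hence \<open>\<phi>\<close> gives the correct value on all pairs of basis vectors, and
  by continuity for all bounded \<open>f\<close> and all \<open>g\<close>.

  Two foundations are developed on the way. The space \<open>L\<^sup>2\<close> is complete and the monomials \<open>z\<^sup>n\<close> form an orthonormal
  basis of it; this yields the projections and the symbol. The trace pairing does not depend on
  the representation of the trace class operator, because it can be computed in an orthonormal basis
  (lemma \<open>nuclear_rep_trace\<close>).
\<close>

section \<open>Complex inner products and orthonormal expansions\<close>

lemma cinner_add_right: "cinner x (y + z) = cinner x y + cinner x z"
  by (metis cinner_add_left cinner_commute complex_cnj_add)

lemma cinner_scaleC_right: "cinner x (a *\<^sub>C y) = cnj a * cinner x y"
  by (metis cinner_commute cinner_scaleC_left complex_cnj_mult)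

lemma cinner_zero_left [simp]: "cinner 0 y = 0"
  using cinner_add_left[of 0 0 y] by simp

lemma cinner_zero_right [simp]: "cinner x 0 = 0"
  using cinner_add_right[of x 0 0] by simp

lemma cinner_minus_left: "cinner (- x) y = - cinner x y"
  using cinner_add_left[of x "- x" y] by (simp add: add_eq_0_iff)

lemma cinner_diff_left: "cinner (x - z) y = cinner x y - cinner z y"
  using cinner_add_left[of x "- z" y] by (simp add: cinner_minus_left)

lemma cinner_sum_left: "cinner (\<Sum>i\<in>F. f i) y = (\<Sum>i\<in>F. cinner (f i) y)"
  by (induction F rule: infinite_finite_induct) (auto simp: cinner_add_left)

lemma cinner_sum_right: "cinner x (\<Sum>i\<in>F. f i) = (\<Sum>i\<in>F. cinner x (f i))"
  by (induction F rule: infinite_finite_induct) (auto simp: cinner_add_right)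

lemma cinner_self: "cinner x x = complex_of_real ((norm x)\<^sup>2)"
proof -
  have "Im (cinner x x) = 0"
    using arg_cong[OF cinner_commute[of x x], of Im] by simp
  then show ?thesis
    by (simp add: complex_eq_iff inner_eq_Re_cinner[symmetric] power2_norm_eq_inner)
qed

lemma norm_scaleC: "norm (c *\<^sub>C x) = norm c * norm x" for x :: "'a::complex_inner"
proof -
  have "complex_of_real ((norm (c *\<^sub>C x))\<^sup>2) = (c * cnj c) * cinner x x"
    by (simp only: cinner_self[symmetric] cinner_scaleC_left cinner_scaleC_right mult_ac)
  also have "\<dots> = complex_of_real ((norm c * norm x)\<^sup>2)"
    by (simp only: cinner_self complex_norm_square[symmetric] of_real_mult power_mult_distrib)
  finally have "(norm (c *\<^sub>C x))\<^sup>2 = (norm c * norm x)\<^sup>2"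
    by (simp only: of_real_eq_iff)
  then show ?thesis
    by simp
qed

lemma scaleC_minus_one: "(-1) *\<^sub>C x = - x" for x :: "'a::complex_inner"
  using scaleR_scaleC[of "-1" x] by simp

text \<open>Rotating \<open>x\<close> by the phase of \<open>\<langle>x, y\<rangle>\<close> makes the product real, which reduces the inequality to
  the one for the real inner product.\<close>

lemma cinner_Cauchy_Schwarz: "norm (cinner x y) \<le> norm x * norm y"
proof (cases "cinner x y = 0")
  case False
  define c where "c = cnj (cinner x y) / norm (cinner x y)"
  have c: "norm c = 1" using False by (simp add: c_def norm_divide)
  have "c * cinner x y = norm (cinner x y)"
    using False by (simp add: c_def complex_norm_square[symmetric] mult.commute power2_eq_square)
  then have "norm (cinner x y) = inner (c *\<^sub>C x) y"
    by (simp add: inner_eq_Re_cinner cinner_scaleC_left)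
  also have "\<dots> \<le> norm (c *\<^sub>C x) * norm y" by (rule norm_cauchy_schwarz)
  finally show ?thesis by (simp add: norm_scaleC c)
qed auto

lemma bounded_linear_cinner_left: "bounded_linear (\<lambda>x. cinner x y)"
  by (rule bounded_linear_intro[where K = "norm y"])
    (auto simp: cinner_add_left scaleR_scaleC cinner_scaleC_left scaleR_conv_of_real
      cinner_Cauchy_Schwarz)

lemma bounded_linear_cinner_right: "bounded_linear (\<lambda>y. cinner x y)"
  by (rule bounded_linear_intro[where K = "norm x"])
    (auto simp: cinner_add_right scaleR_scaleC cinner_scaleC_right scaleR_conv_of_real mult.commute
      intro: order_trans[OF cinner_Cauchy_Schwarz])

lemma closed_ortho_complement: "closed (ortho_complement M)"
proof -
  have "ortho_complement M = (\<Inter>y\<in>M. {x. cinner x y = 0})"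
    by (auto simp: ortho_complement_def)
  moreover have "closed {x. cinner x y = 0}" for y :: 'a
    by (intro closed_Collect_eq continuous_on_const linear_continuous_on bounded_linear_cinner_left)
  ultimately show ?thesis by auto
qed

definition complex_subspace :: "'a::complex_inner set \<Rightarrow> bool" where
  "complex_subspace H \<longleftrightarrow> 0 \<in> H \<and> (\<forall>x\<in>H. \<forall>y\<in>H. x + y \<in> H) \<and> (\<forall>c. \<forall>x\<in>H. c *\<^sub>C x \<in> H)"

lemma complex_subspace_minus: "complex_subspace H \<Longrightarrow> x \<in> H \<Longrightarrow> - x \<in> H"
  by (metis complex_subspace_def scaleC_minus_one)

lemma complex_subspace_ortho_complement: "complex_subspace (ortho_complement M)"
  by (auto simp: complex_subspace_def ortho_complement_def cinner_add_left cinner_scaleC_left)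

lemma complex_subspace_sum:
  assumes "complex_subspace H" "\<And>i. i \<in> F \<Longrightarrow> x i \<in> H"
  shows "(\<Sum>i\<in>F. c i *\<^sub>C x i) \<in> H"
  using assms(2) by (induction F rule: infinite_finite_induct)
    (use assms(1) in \<open>simp_all add: complex_subspace_def\<close>)

definition orthonormal :: "'i set \<Rightarrow> ('i \<Rightarrow> 'a::complex_inner) \<Rightarrow> bool" where
  "orthonormal I x \<longleftrightarrow> (\<forall>i\<in>I. \<forall>j\<in>I. cinner (x i) (x j) = (if i = j then 1 else 0))"

lemma orthonormal_cinner_sum:
  assumes "orthonormal I x" "finite F" "F \<subseteq> I" "j \<in> F"
  shows "cinner (\<Sum>i\<in>F. c i *\<^sub>C x i) (x j) = c j"
proof -
  have "cinner (\<Sum>i\<in>F. c i *\<^sub>C x i) (x j) = (\<Sum>i\<in>F. if i = j then c j else 0)"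
    unfolding cinner_sum_left cinner_scaleC_left
    using assms by (intro sum.cong refl) (auto simp: orthonormal_def subset_eq)
  then show ?thesis using assms by simp
qed

lemma orthonormal_norm_sum:
  assumes "orthonormal I x" "finite F" "F \<subseteq> I"
  shows "(norm (\<Sum>i\<in>F. c i *\<^sub>C x i))\<^sup>2 = (\<Sum>i\<in>F. (norm (c i))\<^sup>2)"
proof -
  have "complex_of_real ((norm (\<Sum>i\<in>F. c i *\<^sub>C x i))\<^sup>2) =
      (\<Sum>j\<in>F. cnj (c j) * cinner (\<Sum>i\<in>F. c i *\<^sub>C x i) (x j))"
    unfolding cinner_self[symmetric] by (subst cinner_sum_right) (simp add: cinner_scaleC_right)
  also have "\<dots> = (\<Sum>j\<in>F. cnj (c j) * c j)"
    by (intro sum.cong refl) (simp add: orthonormal_cinner_sum[OF assms])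
  also have "\<dots> = complex_of_real (\<Sum>i\<in>F. (norm (c i))\<^sup>2)"
    unfolding of_real_sum by (simp only: complex_norm_square mult.commute)
  finally show ?thesis by (simp only: of_real_eq_iff)
qed

text \<open>Bessel's inequality for a bounded functional given by its values \<open>l i\<close> on an orthonormal
  family: test the bound on \<open>\<Sum>i. cnj (l i) x i\<close>. Applied to \<open>\<langle>\<cdot>, f\<rangle>\<close> it is the usual Bessel inequality;
  applied to \<open>\<langle>T \<cdot>, y\<rangle>\<close> it replaces the adjoint of \<open>T\<close>.\<close>

lemma functional_Bessel:
  assumes x: "orthonormal I x" and F: "finite F" "F \<subseteq> I" and C: "0 \<le> C"
    and l: "\<And>c. norm (\<Sum>i\<in>F. c i * l i) \<le> C * norm (\<Sum>i\<in>F. c i *\<^sub>C x i)"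
  shows "(\<Sum>i\<in>F. (norm (l i))\<^sup>2) \<le> C\<^sup>2"
proof -
  define s where "s = (\<Sum>i\<in>F. (norm (l i))\<^sup>2)"
  have s0: "0 \<le> s" by (simp add: s_def sum_nonneg)
  have "(\<Sum>i\<in>F. cnj (l i) * l i) = complex_of_real s"
    unfolding s_def of_real_sum by (simp only: complex_norm_square mult.commute)
  then have "s = norm (\<Sum>i\<in>F. cnj (l i) * l i)"
    using s0 by simp
  also have "\<dots> \<le> C * norm (\<Sum>i\<in>F. cnj (l i) *\<^sub>C x i)"
    by (rule l)
  finally have "s\<^sup>2 \<le> (C * norm (\<Sum>i\<in>F. cnj (l i) *\<^sub>C x i))\<^sup>2"
    using s0 by (simp add: power_mono)
  also have "\<dots> = C\<^sup>2 * s"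
    by (simp add: power_mult_distrib orthonormal_norm_sum[OF x F] s_def)
  finally have "s * s \<le> C\<^sup>2 * s" by (simp add: power2_eq_square)
  then show ?thesis
    using s0 by (cases "s = 0") (auto simp: s_def[symmetric])
qed

lemma Bessel_inequality:
  assumes "orthonormal I x" "finite F" "F \<subseteq> I"
  shows "(\<Sum>i\<in>F. (norm (cinner f (x i)))\<^sup>2) \<le> (norm f)\<^sup>2"
proof -
  have "(\<Sum>i\<in>F. (norm (cinner (x i) f))\<^sup>2) \<le> (norm f)\<^sup>2"
  proof (rule functional_Bessel[OF assms])
    fix c :: "'a \<Rightarrow> complex"
    show "norm (\<Sum>i\<in>F. c i * cinner (x i) f) \<le> norm f * norm (\<Sum>i\<in>F. c i *\<^sub>C x i)"
      using cinner_Cauchy_Schwarz[of "\<Sum>i\<in>F. c i *\<^sub>C x i" f]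
      by (simp add: cinner_sum_left cinner_scaleC_left mult.commute)
  qed simp
  then show ?thesis by (metis (no_types, lifting) cinner_commute complex_mod_cnj sum.cong)
qed

lemma bounded_sums_imp_summable_on:
  fixes a :: "'i \<Rightarrow> real"
  assumes "\<And>i. i \<in> I \<Longrightarrow> 0 \<le> a i" "\<And>F. finite F \<Longrightarrow> F \<subseteq> I \<Longrightarrow> sum a F \<le> B"
  shows "a summable_on I"
proof (rule nonneg_bdd_above_summable_on)
  show "bdd_above (sum a ` {F. F \<subseteq> I \<and> finite F})"
    using assms(2) by (auto simp: bdd_above_def)
qed (use assms(1) in auto)

text \<open>The Riesz--Fischer theorem. The square norm of a block of the series is the corresponding block
  of \<open>\<Sum>i. \<bar>c i\<bar>\<^sup>2\<close>, so that the Cauchy property passes from one series to the other.\<close>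

lemma Riesz_Fischer:
  fixes x :: "'i \<Rightarrow> 'a::{complex_inner, complete_space}"
  assumes x: "orthonormal I x" and c: "(\<lambda>i. (norm (c i))\<^sup>2) summable_on I"
  shows "(\<lambda>i. c i *\<^sub>C x i) summable_on I"
proof -
  let ?s = "\<lambda>F. \<Sum>i\<in>F. c i *\<^sub>C x i" and ?q = "\<lambda>F. \<Sum>i\<in>F. (norm (c i))\<^sup>2"
  obtain L where L: "(?q \<longlongrightarrow> L) (finite_subsets_at_top I)"
    using c unfolding summable_on_def has_sum_def by auto
  have "\<exists>P. eventually P (finite_subsets_at_top I) \<and>
      (\<forall>F F'. P F \<and> P F' \<longrightarrow> dist (?s F) (?s F') < e)" if "e > 0" for e
  proof -
    have e: "0 < (e / 2)\<^sup>2 / 2" using that by simp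
    obtain G where G: "finite G" "G \<subseteq> I"
      and near: "\<forall>F. finite F \<and> G \<subseteq> F \<and> F \<subseteq> I \<longrightarrow> dist (?q F) L < (e / 2)\<^sup>2 / 2"
      using tendstoD[OF L e] unfolding eventually_finite_subsets_at_top by auto
    have close: "dist (?s F) (?s G) < e / 2" if F: "finite F" "G \<subseteq> F" "F \<subseteq> I" for F
    proof -
      have "?s F - ?s G = ?s (F - G)" "?q F - ?q G = ?q (F - G)"
        by (rule sum_diff[symmetric, OF F(1,2)])+
      then have "(norm (?s F - ?s G))\<^sup>2 = ?q F - ?q G"
        using orthonormal_norm_sum[OF x, of "F - G" c] F by auto
      also have "\<dots> \<le> dist (?q F) L + dist (?q G) L"
        by (simp add: dist_real_def)
      also have "\<dots> < (e / 2)\<^sup>2"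
        using near[rule_format, of F] near[rule_format, of G] F G by auto
      finally show ?thesis
        unfolding dist_norm by (rule power_less_imp_less_base) (use \<open>e > 0\<close> in simp)
    qed
    have "dist (?s F) (?s F') < e"
      if "finite F" "G \<subseteq> F" "F \<subseteq> I" "finite F'" "G \<subseteq> F'" "F' \<subseteq> I" for F F'
      by (rule dist_triangle_half_l[OF close close]) (use that in auto)
    moreover have "eventually (\<lambda>F. finite F \<and> G \<subseteq> F \<and> F \<subseteq> I) (finite_subsets_at_top I)"
      using G unfolding eventually_finite_subsets_at_top by auto
    ultimately show ?thesis
      by (intro exI[of _ "\<lambda>F. finite F \<and> G \<subseteq> F \<and> F \<subseteq> I"]) simp
  qed
  then have "cauchy_filter (filtermap ?s (finite_subsets_at_top I))"
    by (simp add: cauchy_filter_metric_filtermap)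
  moreover have "complete (UNIV :: 'a set)"
    by (meson Cauchy_convergent UNIV_I complete_def convergent_def)
  ultimately obtain s where "(?s \<longlongrightarrow> s) (finite_subsets_at_top I)"
    using complete_uniform[where S = UNIV] by (force simp add: filterlim_def)
  then show ?thesis
    unfolding summable_on_def has_sum_def by blast
qed

lemma has_sum_cinner_left:
  assumes "((\<lambda>i. c i *\<^sub>C x i) has_sum f) I"
  shows "((\<lambda>i. c i * cinner (x i) y) has_sum cinner f y) I"
  using has_sum_bounded_linear[OF bounded_linear_cinner_left[of y] assms]
  by (simp add: cinner_scaleC_left)

lemma has_sum_cinner_right:
  assumes "((\<lambda>i. c i *\<^sub>C x i) has_sum f) I"
  shows "((\<lambda>i. cnj (c i) * cinner y (x i)) has_sum cinner y f) I"
  using has_sum_bounded_linear[OF bounded_linear_cinner_right[of y] assms]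
  by (simp add: cinner_scaleC_right)

lemma orthonormal_coefficient:
  assumes x: "orthonormal I x" and f: "((\<lambda>i. c i *\<^sub>C x i) has_sum f) I" and j: "j \<in> I"
  shows "cinner f (x j) = c j"
proof -
  have "((\<lambda>i. c i * cinner (x i) (x j)) has_sum cinner f (x j)) I"
    by (rule has_sum_cinner_left[OF f])
  moreover have "((\<lambda>i. c i * cinner (x i) (x j)) has_sum c j) I"
  proof -
    have "((\<lambda>i. c i * cinner (x i) (x j)) has_sum (\<Sum>i\<in>{j}. c i * cinner (x i) (x j))) {j}"
      by (rule has_sum_finite) simp
    then show ?thesis
      using x j by (subst has_sum_cong_neutral[where T = "{j}" and g = "\<lambda>i. c i * cinner (x i) (x j)"])
        (auto simp: orthonormal_def)
  qed
  ultimately show ?thesis by (rule has_sum_unique)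
qed

text \<open>The expansions are unordered sums, so that bases indexed by \<open>\<int>\<close> or by a half-line of \<open>\<int>\<close>
  need no enumeration.\<close>

definition orthonormal_basis :: "'i set \<Rightarrow> ('i \<Rightarrow> 'a::complex_inner) \<Rightarrow> 'a set \<Rightarrow> bool" where
  "orthonormal_basis I x H \<longleftrightarrow> orthonormal I x \<and> x ` I \<subseteq> H \<and>
     (\<forall>f\<in>H. ((\<lambda>i. cinner f (x i) *\<^sub>C x i) has_sum f) I)"

lemma closed_subspace_has_sum:
  assumes H: "complex_subspace H" "closed H" and x: "\<And>i. i \<in> I \<Longrightarrow> x i \<in> H"
    and f: "((\<lambda>i. c i *\<^sub>C x i) has_sum f) I"
  shows "f \<in> H"
proof (rule Lim_in_closed_set[OF H(2)])
  show "((\<lambda>F. \<Sum>i\<in>F. c i *\<^sub>C x i) \<longlongrightarrow> f) (finite_subsets_at_top I)"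
    using f unfolding has_sum_def .
  show "eventually (\<lambda>F. (\<Sum>i\<in>F. c i *\<^sub>C x i) \<in> H) (finite_subsets_at_top I)"
    by (rule eventually_finite_subsets_at_top_weakI) (use x in \<open>auto intro!: complex_subspace_sum[OF H(1)]\<close>)
qed simp

text \<open>The Fourier series of \<open>f\<close> with respect to the family \<open>x\<close> is the only candidate for the component
  of \<open>f\<close> in the closed span of \<open>x\<close>; what remains is orthogonal to \<open>x\<close>.\<close>

lemma orthonormal_decomposition:
  fixes x :: "'i \<Rightarrow> 'a::{complex_inner, complete_space}"
  assumes x: "orthonormal I x"
  obtains g where "((\<lambda>i. cinner f (x i) *\<^sub>C x i) has_sum g) I" "\<And>i. i \<in> I \<Longrightarrow> cinner (f - g) (x i) = 0"
proof -
  have "(\<lambda>i. (norm (cinner f (x i)))\<^sup>2) summable_on I"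
    by (rule bounded_sums_imp_summable_on[where B = "(norm f)\<^sup>2"]) (auto simp: Bessel_inequality[OF x])
  from Riesz_Fischer[OF x this] obtain g where g: "((\<lambda>i. cinner f (x i) *\<^sub>C x i) has_sum g) I"
    unfolding summable_on_def by auto
  with orthonormal_coefficient[OF x g] that show thesis
    by (simp add: cinner_diff_left)
qed


section \<open>Functions representing elements of \<open>L\<^sup>2\<close>, and completeness\<close>

interpretation circle: prob_space circle_measure
  by (rule prob_space_circle_measure)

lemma space_circle_measure [simp]: "space circle_measure = UNIV"
  by (simp add: circle_measure_def)

lemma sets_circle_measure [simp, measurable_cong]: "sets circle_measure = sets borel"
  by (simp add: circle_measure_def)

lemma square_integrable_rep_L2: "square_integrable (rep_L2 f)"
  using Quotient3_rep_reflp[OF Quotient3_L2] by blast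

lemma abs_rep_L2 [simp]: "abs_L2 (rep_L2 f) = f"
  using Quotient3_abs_rep[OF Quotient3_L2] .

lemma rep_L2_measurable [measurable]: "rep_L2 f \<in> borel_measurable circle_measure"
  using square_integrable_rep_L2[of f] by (simp add: square_integrable_def)

lemma abs_L2_eqI:
  assumes "square_integrable f" "square_integrable g" "AE z in circle_measure. f z = g z"
  shows "abs_L2 f = abs_L2 g"
  using assms by (intro Quotient3_rel_abs[OF Quotient3_L2]) auto

lemma rep_abs_L2:
  assumes "square_integrable f"
  shows "AE z in circle_measure. rep_L2 (abs_L2 f) z = f z"
proof -
  have "square_integrable (rep_L2 (abs_L2 f)) \<and> square_integrable f \<and>
      (AE z in circle_measure. rep_L2 (abs_L2 f) z = f z)"
    by (rule Quotient3_rep_abs[OF Quotient3_L2]) (use assms in auto)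
  then show ?thesis by simp
qed

lemma rep_L2_add: "AE z in circle_measure. rep_L2 (f + g) z = rep_L2 f z + rep_L2 g z"
proof -
  have "f + g = abs_L2 (\<lambda>z. rep_L2 f z + rep_L2 g z)"
    using plus_L2.abs_eq[of "rep_L2 f" "rep_L2 g"] by (simp add: square_integrable_rep_L2)
  then show ?thesis
    by (simp add: rep_abs_L2 square_integrable_add square_integrable_rep_L2)
qed

lemma rep_L2_diff: "AE z in circle_measure. rep_L2 (f - g) z = rep_L2 f z - rep_L2 g z"
  using rep_L2_add[of "f - g" g] by (auto elim: eventually_mono)

lemma cinner_L2_integral: "cinner f g = (LINT z|circle_measure. rep_L2 f z * cnj (rep_L2 g z))"
  by (rule cinner_L2.rep_eq)

lemma cnj_measurable [measurable]: "cnj \<in> borel_measurable borel"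
  by (intro borel_measurable_continuous_onI continuous_intros)

lemma cinner_L2_integral_AE:
  assumes "AE z in circle_measure. rep_L2 f z = u z" "AE z in circle_measure. rep_L2 g z = v z"
    and [measurable]: "u \<in> borel_measurable circle_measure" "v \<in> borel_measurable circle_measure"
  shows "cinner f g = (LINT z|circle_measure. u z * cnj (v z))"
  unfolding cinner_L2_integral using assms(1,2) by (intro integral_cong_AE) auto

lemma norm_L2_integral: "(norm f)\<^sup>2 = (LINT z|circle_measure. (norm (rep_L2 f z))\<^sup>2)"
proof -
  have "complex_of_real ((norm f)\<^sup>2) = complex_of_real (LINT z|circle_measure. (norm (rep_L2 f z))\<^sup>2)"
    unfolding cinner_self[symmetric] cinner_L2_integral integral_complex_of_real[symmetric]
      complex_norm_square ..
  then show ?thesis by (simp only: of_real_eq_iff)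
qed

lemma square_integrable_norm_sq: "integrable circle_measure (\<lambda>z. (norm (rep_L2 f z))\<^sup>2)"
  using square_integrable_rep_L2[of f] by (simp add: square_integrable_def)

lemma norm_L2_nn_integral:
  "(\<integral>\<^sup>+z. ennreal ((norm (rep_L2 f z))\<^sup>2) \<partial>circle_measure) = ennreal ((norm f)\<^sup>2)"
  by (simp add: norm_L2_integral nn_integral_eq_integral[OF square_integrable_norm_sq])

lemma square_integrable_imp_integrable:
  assumes "square_integrable f" shows "integrable circle_measure f"
  using square_integrable_mult[OF assms, of "\<lambda>_. 1"] by (simp add: square_integrable_def)

lemma L1_norm_le_L2_norm:
  assumes "norm f \<le> a" "0 < a"
  shows "(\<integral>\<^sup>+z. ennreal (norm (rep_L2 f z)) \<partial>circle_measure) \<le> ennreal a"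
proof -
  have int: "integrable circle_measure (\<lambda>z. a / 2 + (norm (rep_L2 f z))\<^sup>2 / (2 * a))"
    using square_integrable_norm_sq by auto
  (* The inequality of arithmetic and geometric means with weight a bounds the integrand by a constant
     plus a multiple of its square, and the weight makes the resulting bound equal to a. *)
  have "x \<le> a / 2 + x\<^sup>2 / (2 * a)" for x :: real
    using assms(2) sum_squares_bound[of x a] by (simp add: field_simps power2_eq_square)
  then have "(\<integral>\<^sup>+z. ennreal (norm (rep_L2 f z)) \<partial>circle_measure) \<le>
      (\<integral>\<^sup>+z. ennreal (a / 2 + (norm (rep_L2 f z))\<^sup>2 / (2 * a)) \<partial>circle_measure)"
    by (intro nn_integral_mono ennreal_leI)
  also have "\<dots> = ennreal (LINT z|circle_measure. a / 2 + (norm (rep_L2 f z))\<^sup>2 / (2 * a))"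
    using int assms(2) by (intro nn_integral_eq_integral) auto
  also have "(LINT z|circle_measure. a / 2 + (norm (rep_L2 f z))\<^sup>2 / (2 * a)) =
      a / 2 + (norm f)\<^sup>2 / (2 * a)"
    using square_integrable_norm_sq
    by (subst Bochner_Integration.integral_add) (auto simp: norm_L2_integral circle.prob_space[simplified])
  also have "(norm f)\<^sup>2 / (2 * a) \<le> a\<^sup>2 / (2 * a)"
    using assms by (intro divide_right_mono power_mono) auto
  finally show ?thesis
    using assms(2) by (simp add: power2_eq_square ennreal_leI order_trans)
qed

text \<open>The usual proof of completeness: a subsequence with increments below \<open>2\<^sup>-\<^sup>k\<close> in norm has
  absolutely summable increments almost everywhere, and Fatou's lemma shows that its pointwise limit is
  the limit in norm.\<close>

lemma L2_Cauchy_convergent: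
  fixes F :: "nat \<Rightarrow> L2"
  assumes "Cauchy F"
  shows "convergent F"
proof -
  have "\<exists>N. \<forall>m\<ge>N. \<forall>n\<ge>N. dist (F m) (F n) < (1/2)^k" for k :: nat
    using assms by (intro metric_CauchyD) auto
  then obtain r where r: "\<And>k m n. r k \<le> m \<Longrightarrow> r k \<le> n \<Longrightarrow> dist (F m) (F n) < (1/2)^k"
    by metis
  (* Partial sums turn the thresholds r into a nondecreasing sequence that dominates them. *)
  define s where "s k = (\<Sum>i\<le>k. r i)" for k
  have s: "r k \<le> s k" for k
    unfolding s_def by (rule member_le_sum) auto
  have s_mono: "r k \<le> s l" if "k \<le> l" for k l
    unfolding s_def using that by (intro member_le_sum) auto
  define u where "u k = rep_L2 (F (s k))" for k
  define d where "d k = rep_L2 (F (s (Suc k)) - F (s k))" for k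
  have [measurable]: "u k \<in> borel_measurable circle_measure" "d k \<in> borel_measurable circle_measure" for k
    by (simp_all add: u_def d_def)
  have "AE z in circle_measure. \<forall>k. d k z = u (Suc k) z - u k z"
    unfolding AE_all_countable u_def d_def by (auto intro: rep_L2_diff)
  moreover have "AE z in circle_measure. summable (\<lambda>k. norm (d k z))"
  proof -
    have "norm (F (s (Suc k)) - F (s k)) \<le> (1/2)^k" for k
      using r[of k "s (Suc k)" "s k"] s_mono[of k "Suc k"] s[of k] by (simp add: dist_norm)
    then have "(\<integral>\<^sup>+z. ennreal (norm (d k z)) \<partial>circle_measure) \<le> ennreal ((1/2)^k)" for k
      unfolding d_def by (intro L1_norm_le_L2_norm) auto
    then have "(\<Sum>k. \<integral>\<^sup>+z. ennreal (norm (d k z)) \<partial>circle_measure) \<le> (\<Sum>k. ennreal ((1/2)^k))"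
      by (intro suminf_le) auto
    also have "\<dots> = ennreal (\<Sum>k. (1/2)^k)"
      by (intro suminf_ennreal2) (auto intro: summable_geometric)
    finally have "(\<integral>\<^sup>+z. (\<Sum>k. ennreal (norm (d k z))) \<partial>circle_measure) \<noteq> \<infinity>"
      by (subst nn_integral_suminf) (auto simp: top_unique)
    then have "AE z in circle_measure. (\<Sum>k. ennreal (norm (d k z))) \<noteq> \<infinity>"
      by (intro nn_integral_PInf_AE) auto
    then show ?thesis
      by eventually_elim (auto intro: summable_suminf_not_top)
  qed
  ultimately have conv: "AE z in circle_measure. convergent (\<lambda>k. u k z)"
  proof eventually_elim
    case (elim z)
    have "u k z = u 0 z + (\<Sum>i<k. d i z)" for k
      by (induction k) (simp_all add: elim(1))
    then have "(\<lambda>k. u k z) = (\<lambda>k. u 0 z + (\<Sum>i<k. d i z))"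
      by (rule ext)
    moreover have "convergent (\<lambda>k. \<Sum>i<k. d i z)"
      using summable_norm_cancel[OF elim(2)] by (simp add: summable_iff_convergent)
    ultimately show ?case
      by (simp only:) (intro convergent_add convergent_const)
  qed
  define g where "g z = lim (\<lambda>k. u k z)" for z
  have [measurable]: "g \<in> borel_measurable circle_measure"
    unfolding g_def by measurable
  have lim: "AE z in circle_measure. (\<lambda>k. u k z) \<longlonglongrightarrow> g z"
    using conv by eventually_elim (simp add: g_def convergent_LIMSEQ_iff)
  have bound: "(\<integral>\<^sup>+z. ennreal ((norm (rep_L2 (F m) z - g z))\<^sup>2) \<partial>circle_measure) \<le>
      ennreal (((1/2)^K)\<^sup>2)" if m: "r K \<le> m" for m K
  proof -
    have "(\<integral>\<^sup>+z. ennreal ((norm (rep_L2 (F m) z - g z))\<^sup>2) \<partial>circle_measure) =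
        (\<integral>\<^sup>+z. liminf (\<lambda>k. ennreal ((norm (rep_L2 (F m) z - u k z))\<^sup>2)) \<partial>circle_measure)"
    proof (rule nn_integral_cong_AE, use lim in eventually_elim)
      case (elim z)
      then have "(\<lambda>k. ennreal ((norm (rep_L2 (F m) z - u k z))\<^sup>2)) \<longlonglongrightarrow>
          ennreal ((norm (rep_L2 (F m) z - g z))\<^sup>2)"
        by (intro tendsto_intros)
      then show ?case by (rule lim_imp_Liminf[symmetric, OF sequentially_bot])
    qed
    also have "\<dots> \<le> liminf (\<lambda>k. \<integral>\<^sup>+z. ennreal ((norm (rep_L2 (F m) z - u k z))\<^sup>2) \<partial>circle_measure)"
      by (rule nn_integral_liminf) measurable
    also have "\<dots> \<le> liminf (\<lambda>k. ennreal (((1/2)^K)\<^sup>2))"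
    proof (rule Liminf_mono)
      show "eventually (\<lambda>k. (\<integral>\<^sup>+z. ennreal ((norm (rep_L2 (F m) z - u k z))\<^sup>2) \<partial>circle_measure) \<le>
          ennreal (((1/2)^K)\<^sup>2)) sequentially"
        unfolding eventually_sequentially
      proof (intro exI allI impI)
        fix k assume "K \<le> k"
        have "(\<integral>\<^sup>+z. ennreal ((norm (rep_L2 (F m) z - u k z))\<^sup>2) \<partial>circle_measure) =
            (\<integral>\<^sup>+z. ennreal ((norm (rep_L2 (F m - F (s k)) z))\<^sup>2) \<partial>circle_measure)"
          using rep_L2_diff[of "F m" "F (s k)"]
          by (intro nn_integral_cong_AE) (auto simp: u_def elim: eventually_mono)
        also have "\<dots> = ennreal ((dist (F m) (F (s k)))\<^sup>2)"
          by (simp add: norm_L2_nn_integral dist_norm)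
        also have "\<dots> \<le> ennreal (((1/2)^K)\<^sup>2)"
          using r[OF m s_mono[OF \<open>K \<le> k\<close>]] by (intro ennreal_leI power_mono) auto
        finally show "(\<integral>\<^sup>+z. ennreal ((norm (rep_L2 (F m) z - u k z))\<^sup>2) \<partial>circle_measure) \<le>
          ennreal (((1/2)^K)\<^sup>2)" .
      qed
    qed
    also have "\<dots> = ennreal (((1/2)^K)\<^sup>2)"
      by (simp add: Liminf_const)
    finally show ?thesis .
  qed
  have sq: "square_integrable (\<lambda>z. rep_L2 (F (r 0)) z - g z)"
    using bound[of 0 "r 0"]
    by (auto simp: square_integrable_def integrable_iff_bounded intro: le_less_trans)
  have sg: "square_integrable g"
    using square_integrable_add[OF square_integrable_rep_L2[of "F (r 0)"] square_integrable_scale[OF sq, of "-1"]]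
    by simp
  have near: "dist (F m) (abs_L2 g) \<le> (1/2)^K" if m: "r K \<le> m" for m K
  proof -
    have "ennreal ((dist (F m) (abs_L2 g))\<^sup>2) =
        (\<integral>\<^sup>+z. ennreal ((norm (rep_L2 (F m - abs_L2 g) z))\<^sup>2) \<partial>circle_measure)"
      by (simp add: norm_L2_nn_integral dist_norm)
    also have "\<dots> = (\<integral>\<^sup>+z. ennreal ((norm (rep_L2 (F m) z - g z))\<^sup>2) \<partial>circle_measure)"
      using rep_L2_diff[of "F m" "abs_L2 g"] rep_abs_L2[OF sg] by (intro nn_integral_cong_AE) auto
    also note bound[OF m]
    finally have "(dist (F m) (abs_L2 g))\<^sup>2 \<le> ((1/2)^K)\<^sup>2"
      by simp
    then show ?thesis by (rule power2_le_imp_le) simp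
  qed
  have "F \<longlonglongrightarrow> abs_L2 g"
  proof (rule metric_LIMSEQ_I)
    fix e :: real assume "0 < e"
    then obtain K where "(1/2)^K < e" using real_arch_pow_inv[of e "1/2"] by auto
    with near show "\<exists>N. \<forall>n\<ge>N. dist (F n) (abs_L2 g) < e" by (meson le_less_trans)
  qed
  then show ?thesis by (rule convergentI)
qed

instance L2 :: complete_space
  by standard (rule L2_Cauchy_convergent)


section \<open>Monomials on the circle and uniqueness of Fourier coefficients\<close>

lemma cis_measurable [measurable]: "cis \<in> borel_measurable borel"
  by (intro borel_measurable_continuous_onI continuous_intros)

lemma AE_circle_norm: "AE z in circle_measure. norm z = 1"
proof -
  have "cis \<in> measurable (uniform_measure lborel {0..<2 * pi}) borel"
    by measurable
  moreover have "{z :: complex \<in> space borel. norm z = 1} \<in> sets borel"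
    by measurable
  ultimately show ?thesis
    unfolding circle_measure_def by (subst AE_distr_iff) auto
qed

lemma powi_measurable [measurable]: "(\<lambda>z::complex. z powi n) \<in> borel_measurable borel"
  unfolding power_int_def by simp

lemma norm_powi_unit: "norm z = 1 \<Longrightarrow> norm (z powi n) = 1" for z :: complex
  by (simp add: norm_power_int)

lemma cnj_powi_unit: "cnj (z powi n) = z powi (- n)" if "norm z = 1" for z :: complex
proof -
  have "z * cnj z = 1" using that by (simp add: complex_norm_square[symmetric])
  then have "cnj z = inverse z" by (metis inverse_unique)
  then show ?thesis by (simp add: complex_cnj_power_int power_int_inverse power_int_minus)
qed

lemma integral_circle_measure:
  fixes f :: "complex \<Rightarrow> complex"
  assumes [measurable]: "f \<in> borel_measurable borel"
  shows "(LINT z|circle_measure. f z) = (LINT t|lborel. (indicator {0..<2*pi} t / (2*pi)) *\<^sub>R f (cis t))"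
proof -
  have "uniform_measure lborel {0..<2*pi} = density lborel (\<lambda>t. ennreal (indicator {0..<2*pi} t / (2*pi)))"
    unfolding uniform_measure_def
    by (intro arg_cong[where f = "density lborel"] ext)
      (simp add: divide_ennreal[symmetric] ennreal_indicator del: divide_ennreal)
  then show ?thesis
    unfolding circle_measure_def
    by (simp add: integral_distr integral_density)
qed

lemma integral_powi: "(LINT z|circle_measure. z powi n) = (if n = 0 then 1 else 0)"
proof (cases "n = 0")
  case True
  then show ?thesis by (simp add: circle.prob_space[simplified])
next
  case False
  define F where "F t = exp (\<i> * of_int n * of_real t) / (\<i> * of_int n)" for t :: real
  have "((\<lambda>w. exp (\<i> * of_int n * w) / (\<i> * of_int n)) has_field_derivative exp (\<i> * of_int n * w)) (at w)" for w
    using False by (auto intro!: derivative_eq_intros)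
  then have deriv: "(F has_vector_derivative exp (\<i> * of_int n * of_real t)) (at t within {0..2*pi})" for t
    unfolding F_def by (rule has_vector_derivative_real_field)
  have "has_bochner_integral lborel (\<lambda>t. indicator {0..2*pi} t *\<^sub>R exp (\<i> * of_int n * of_real t)) (F (2*pi) - F 0)"
    by (rule has_bochner_integral_FTC_Icc) (auto intro!: deriv continuous_intros)
  moreover have "F (2*pi) = F 0"
  proof -
    have "\<i> * of_int n * of_real (2*pi) = 2 * of_int n * of_real pi * \<i>" by simp
    then have "exp (\<i> * of_int n * of_real (2*pi)) = 1"
      using exp_integer_2pi[of "of_int n"] by (simp only:) simp
    then show ?thesis by (simp add: F_def)
  qed
  ultimately have zero: "(LINT t|lborel. indicator {0..2*pi} t *\<^sub>R exp (\<i> * of_int n * of_real t)) = 0"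
    by (simp add: has_bochner_integral_integral_eq)
  have "(LINT z|circle_measure. z powi n) =
      (LINT t|lborel. (indicator {0..<2*pi} t / (2*pi)) *\<^sub>R exp (\<i> * of_int n * of_real t))"
  proof (subst integral_circle_measure)
    have "cis t powi n = exp (\<i> * of_int n * of_real t)" for t
      unfolding cis_power_int by (simp add: cis_conv_exp mult_ac)
    then show "(LINT t|lborel. (indicator {0..<2*pi} t / (2*pi)) *\<^sub>R (cis t powi n)) =
        (LINT t|lborel. (indicator {0..<2*pi} t / (2*pi)) *\<^sub>R exp (\<i> * of_int n * of_real t))"
      by (simp only:)
  qed measurable
  also have "\<dots> = (LINT t|lborel. (1 / (2*pi)) *\<^sub>R (indicator {0..2*pi} t *\<^sub>R exp (\<i> * of_int n * of_real t)))"
  proof (intro integral_cong_AE)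
    show "AE t in lborel. (indicator {0..<2*pi} t / (2*pi)) *\<^sub>R exp (\<i> * of_int n * of_real t) =
        (1 / (2*pi)) *\<^sub>R (indicator {0..2*pi} t *\<^sub>R exp (\<i> * of_int n * of_real t))"
      using AE_lborel_singleton[of "2*pi"] by eventually_elim (auto simp: indicator_def)
  qed measurable
  also have "\<dots> = 0"
    by (subst integral_scaleR_right) (simp add: zero)
  finally show ?thesis using False by simp
qed

lemma square_integrable_bounded:
  assumes "f \<in> borel_measurable circle_measure" "AE z in circle_measure. norm (f z) \<le> C"
  shows "square_integrable f"
  unfolding square_integrable_def
proof
  show "integrable circle_measure (\<lambda>z. (norm (f z))\<^sup>2)"
  proof (rule circle.integrable_const_bound[of _ "C\<^sup>2"])
    show "AE z in circle_measure. norm ((norm (f z))\<^sup>2) \<le> C\<^sup>2"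
      using assms(2) by eventually_elim (simp add: power_mono)
  qed (use assms(1) in measurable)
qed (fact assms(1))

definition zpow :: "int \<Rightarrow> L2" where
  "zpow n = abs_L2 (\<lambda>z. z powi n)"

lemma square_integrable_powi: "square_integrable (\<lambda>z. z powi n)"
proof (rule square_integrable_bounded)
  show "AE z in circle_measure. norm (z powi n) \<le> 1"
    using AE_circle_norm by eventually_elim (simp add: norm_powi_unit)
qed measurable

lemma rep_zpow: "AE z in circle_measure. rep_L2 (zpow n) z = z powi n"
  unfolding zpow_def by (rule rep_abs_L2[OF square_integrable_powi])

lemma fourier_coeff_cinner: "fourier_coeff f n = cinner f (zpow n)"
proof -
  have "cinner f (zpow n) = (LINT z|circle_measure. rep_L2 f z * cnj (z powi n))"
    by (rule cinner_L2_integral_AE) (auto intro: rep_zpow)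
  also have "\<dots> = (LINT z|circle_measure. rep_L2 f z * z powi (- n))"
  proof (intro integral_cong_AE)
    show "AE z in circle_measure. rep_L2 f z * cnj (z powi n) = rep_L2 f z * z powi (- n)"
      using AE_circle_norm by eventually_elim (simp only: cnj_powi_unit)
  qed measurable
  finally show ?thesis by (simp add: fourier_coeff.rep_eq)
qed

lemma orthonormal_zpow: "orthonormal I zpow"
proof -
  have "cinner (zpow i) (zpow j) = (if i = j then 1 else 0)" for i j
  proof -
    have "cinner (zpow i) (zpow j) = (LINT z|circle_measure. z powi i * z powi (- j))"
      unfolding fourier_coeff_cinner[symmetric] fourier_coeff.rep_eq
      by (intro integral_cong_AE) (auto intro: eventually_mono[OF rep_zpow])
    also have "\<dots> = (LINT z|circle_measure. z powi (i - j))"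
    proof (intro integral_cong_AE)
      show "AE z in circle_measure. z powi i * z powi (- j) = z powi (i - j)"
        using AE_circle_norm
      proof eventually_elim
        case (elim z)
        then have "z \<noteq> 0" by auto
        then show ?case by (simp add: power_int_add[symmetric])
      qed
    qed measurable
    finally show ?thesis by (simp add: integral_powi)
  qed
  then show ?thesis by (auto simp: orthonormal_def)
qed

text \<open>The functions all of whose Fourier coefficients vanish. They are closed under multiplication
  by the coordinate functions \<open>Re z\<close> and \<open>Im z\<close>, which are combinations of \<open>z\<close> and \<open>1/z\<close> on the circle,
  hence under multiplication by real polynomials.\<close>

definition fourier_null :: "(complex \<Rightarrow> complex) \<Rightarrow> bool" where
  "fourier_null f \<longleftrightarrow> integrable circle_measure f \<and> (\<forall>n. (LINT z|circle_measure. f z * z powi n) = 0)"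

lemma integrable_mult_powi:
  assumes "integrable circle_measure f"
  shows "integrable circle_measure (\<lambda>z. f z * z powi n)"
proof (rule Bochner_Integration.integrable_bound[OF assms])
  show "AE z in circle_measure. norm (f z * z powi n) \<le> norm (f z)"
    using AE_circle_norm by eventually_elim (simp add: norm_mult norm_powi_unit)
  have [measurable]: "f \<in> borel_measurable circle_measure"
    using assms by (rule borel_measurable_integrable)
  show "(\<lambda>z. f z * z powi n) \<in> borel_measurable circle_measure"
    by measurable
qed

lemma fourier_null_powi_combination:
  assumes f: "fourier_null f" and g: "AE z in circle_measure. g z = a * (f z * z powi k) + b * (f z * z powi l)"
    and [measurable]: "g \<in> borel_measurable circle_measure"
  shows "fourier_null g"
proof -
  have int: "integrable circle_measure (\<lambda>z. f z * z powi n)" for n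
    using f by (auto simp: fourier_null_def intro: integrable_mult_powi)
  have int0: "(LINT z|circle_measure. f z * z powi n) = 0" for n
    using f by (auto simp: fourier_null_def)
  have [measurable]: "f \<in> borel_measurable circle_measure"
    using f by (auto simp: fourier_null_def)
  have "integrable circle_measure (\<lambda>z. a * (f z * z powi k) + b * (f z * z powi l))"
    using int by auto
  then have "integrable circle_measure g"
    by (subst integrable_cong_AE[OF _ _ g]) auto
  moreover have "(LINT z|circle_measure. g z * z powi n) = 0" for n
  proof -
    have "(LINT z|circle_measure. g z * z powi n) =
        (LINT z|circle_measure. a * (f z * z powi (k + n)) + b * (f z * z powi (l + n)))"
    proof (intro integral_cong_AE)
      show "AE z in circle_measure. g z * z powi n = a * (f z * z powi (k + n)) + b * (f z * z powi (l + n))"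
        using g AE_circle_norm
      proof eventually_elim
        case (elim z)
        then have "z \<noteq> 0" by auto
        with elim(1) show ?case by (simp add: power_int_add algebra_simps)
      qed
    qed measurable
    then show ?thesis using int by (simp add: int0)
  qed
  ultimately show ?thesis by (simp add: fourier_null_def)
qed

lemma fourier_null_polynomial:
  assumes "real_polynomial_function p" "fourier_null f"
  shows "fourier_null (\<lambda>z. of_real (p z) * f z)"
  using assms
proof (induction p arbitrary: f rule: real_polynomial_function.induct)
  case (linear p)
  have [measurable]: "f \<in> borel_measurable circle_measure"
    using linear by (auto simp: fourier_null_def)
  have [measurable]: "p \<in> borel_measurable borel"
    by (intro borel_measurable_continuous_onI linear_continuous_on linear)
  have p: "p z = Re z * p 1 + Im z * p \<i>" for z
  proof -
    interpret bounded_linear p by fact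
    have "z = Re z *\<^sub>R 1 + Im z *\<^sub>R \<i>" by (simp add: complex_eq_iff)
    then show ?thesis by (metis add scaleR real_scaleR_def)
  qed
  show ?case
  proof (rule fourier_null_powi_combination[OF linear.prems])
    show "AE z in circle_measure. complex_of_real (p z) * f z =
        ((of_real (p 1) - \<i> * of_real (p \<i>)) / 2) * (f z * z powi 1) +
        ((of_real (p 1) + \<i> * of_real (p \<i>)) / 2) * (f z * z powi (-1))"
      using AE_circle_norm
    proof eventually_elim
      case (elim z)
      have inv: "z powi (-1) = cnj z"
        using cnj_powi_unit[OF elim, of 1] by simp
      have "complex_of_real (p z) = ((of_real (p 1) - \<i> * of_real (p \<i>)) / 2) * z +
          ((of_real (p 1) + \<i> * of_real (p \<i>)) / 2) * cnj z"
        by (subst p) (simp add: complex_eq_iff field_simps)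
      then show ?case unfolding inv by (simp add: algebra_simps)
    qed
  qed measurable
next
  case (const c)
  have [measurable]: "f \<in> borel_measurable circle_measure"
    using const by (auto simp: fourier_null_def)
  show ?case
    by (rule fourier_null_powi_combination[OF const, where a = c and b = 0 and k = 0 and l = 0]) auto
next
  case (add p q)
  then have "fourier_null (\<lambda>z. of_real (p z) * f z)" "fourier_null (\<lambda>z. of_real (q z) * f z)" by auto
  then show ?case
    by (auto simp: fourier_null_def distrib_right integrable_mult_powi)
next
  case (mult p q)
  then have "fourier_null (\<lambda>z. of_real (p z) * (of_real (q z) * f z))" by auto
  then show ?case by (simp add: mult.assoc)
qed

text \<open>On the circle a continuous function is a uniform limit of real polynomials.\<close>

lemma fourier_null_continuous:
  assumes f: "fourier_null f" and h: "continuous_on UNIV (h :: complex \<Rightarrow> real)"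
  shows "(LINT z|circle_measure. of_real (h z) * f z) = 0"
proof -
  have int: "integrable circle_measure f" using f by (simp add: fourier_null_def)
  have [measurable]: "f \<in> borel_measurable circle_measure" using int by auto
  have [measurable]: "h \<in> borel_measurable borel" using h by (rule borel_measurable_continuous_onI)
  have "norm (LINT z|circle_measure. of_real (h z) * f z) \<le> e * (LINT z|circle_measure. norm (f z))"
    if e: "e > 0" for e
  proof -
    obtain p where p: "real_polynomial_function p" "\<And>z. z \<in> sphere 0 1 \<Longrightarrow> \<bar>h z - p z\<bar> < e"
      using Stone_Weierstrass_real_polynomial_function[of "sphere 0 1" h e] h e
      by (auto intro: continuous_on_subset)
    have [measurable]: "p \<in> borel_measurable borel"
      using p(1) by (intro borel_measurable_continuous_onI continuous_on_polymonial_function)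
        (simp add: real_polynomial_function_eq)
    have pf: "fourier_null (\<lambda>z. of_real (p z) * f z)"
      by (rule fourier_null_polynomial[OF p(1) f])
    then have pi: "integrable circle_measure (\<lambda>z. of_real (p z) * f z)"
      and p0: "(LINT z|circle_measure. of_real (p z) * f z) = 0"
      unfolding fourier_null_def by (auto dest: spec[of _ 0])
    have close: "AE z in circle_measure. norm (of_real (h z - p z) * f z) \<le> e * norm (f z)"
      using AE_circle_norm
    proof eventually_elim
      case (elim z)
      then have "\<bar>h z - p z\<bar> \<le> e" using p(2)[of z] by simp
      then show ?case unfolding norm_mult norm_of_real by (intro mult_right_mono) auto
    qed
    have di: "integrable circle_measure (\<lambda>z. of_real (h z - p z) * f z)"
      by (rule Bochner_Integration.integrable_bound[of _ "\<lambda>z. e * norm (f z)"])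
        (use int close in \<open>auto elim: eventually_mono\<close>)
    have "(LINT z|circle_measure. of_real (h z) * f z) =
        (LINT z|circle_measure. of_real (h z - p z) * f z + of_real (p z) * f z)"
      by (simp add: algebra_simps)
    also have "\<dots> = (LINT z|circle_measure. of_real (h z - p z) * f z)"
      by (subst Bochner_Integration.integral_add[OF di pi]) (simp add: p0)
    also have "norm \<dots> \<le> (LINT z|circle_measure. norm (of_real (h z - p z) * f z))"
      by (rule integral_norm_bound)
    also have "\<dots> \<le> (LINT z|circle_measure. e * norm (f z))"
      using di int close by (intro integral_mono_AE) auto
    finally show ?thesis by simp
  qed
  note bound = this
  define c where "c = (LINT z|circle_measure. norm (f z))"
  have c: "0 \<le> c" unfolding c_def by simp
  have "norm (LINT z|circle_measure. of_real (h z) * f z) \<le> 0 + e" if e: "0 < e" for e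
  proof -
    have "e / (c + 1) * c \<le> e" using e c by (simp add: field_simps)
    moreover have "0 < e / (c + 1)" using e c by simp
    ultimately show ?thesis using bound[of "e / (c + 1)"] unfolding c_def[symmetric] by linarith
  qed
  then have "norm (LINT z|circle_measure. of_real (h z) * f z) \<le> 0"
    by (rule field_le_epsilon)
  then show ?thesis by simp
qed

text \<open>The indicator of a nonempty closed set \<open>C\<close> is the pointwise limit of the continuous functions
  \<open>max 0 (1 - k dist(z, C))\<close>, and the sets over which the integral of \<open>f\<close> vanishes form a Dynkin system.\<close>

lemma fourier_null_set_integral:
  assumes f: "fourier_null f" and A: "A \<in> sets borel"
  shows "(LINT z:A|circle_measure. f z) = 0"
proof -
  have int: "integrable circle_measure f" using f by (simp add: fourier_null_def)
  have [measurable]: "f \<in> borel_measurable circle_measure" using int by auto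
  have sint: "set_integrable circle_measure B f" if "B \<in> sets borel" for B
    unfolding set_integrable_def using that int by (intro integrable_mult_indicator) auto
  have full: "(LINT z|circle_measure. f z) = 0"
    using f unfolding fourier_null_def by (auto dest: spec[of _ 0])
  have "Int_stable (Collect closed :: complex set set)" "Collect closed \<subseteq> Pow (UNIV :: complex set)"
    "A \<in> sigma_sets UNIV (Collect closed)"
    using A by (auto simp: Int_stable_def borel_eq_closed)
  then show ?thesis
  proof (induction rule: sigma_sets_induct_disjoint)
    case (basic C)
    then have C: "closed C" by simp
    show ?case
    proof (cases "C = {}")
      case False
      define h where "h k z = max 0 (1 - real k * infdist z C)" for k z
      have hc: "continuous_on UNIV (h k)" for k
        unfolding h_def by (intro continuous_intros)
      have [measurable]: "h k \<in> borel_measurable borel" for k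
        using hc by (rule borel_measurable_continuous_onI)
      have [measurable]: "C \<in> sets borel" using C by simp
      have lim: "(\<lambda>k. h k z) \<longlonglongrightarrow> indicator C z" for z
      proof (cases "z \<in> C")
        case True
        then show ?thesis by (simp add: h_def)
      next
        case out: False
        then have "0 < infdist z C"
          using C False infdist_nonneg[of z C] in_closed_iff_infdist_zero[of C z] by fastforce
        then obtain N where N: "1 < real N * infdist z C"
          using reals_Archimedean3 by blast
        have "h k z = 0" if "N \<le> k" for k
        proof -
          have "real N * infdist z C \<le> real k * infdist z C"
            using that infdist_nonneg[of z C] by (intro mult_right_mono) auto
          then show ?thesis using N by (simp add: h_def)
        qed
        then have "eventually (\<lambda>k. h k z = 0) sequentially"
          unfolding eventually_sequentially by blast
        then show ?thesis using out by (simp add: tendsto_eventually)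
      qed
      have "(\<lambda>k. LINT z|circle_measure. of_real (h k z) * f z) \<longlonglongrightarrow>
          (LINT z|circle_measure. of_real (indicator C z) * f z)"
      proof (rule integral_dominated_convergence[where w = "\<lambda>z. norm (f z)"])
        have "norm (of_real (h k z) * f z) \<le> 1 * norm (f z)" for k z
          unfolding norm_mult norm_of_real
          by (intro mult_right_mono) (auto simp: h_def infdist_nonneg)
        then show "AE z in circle_measure. norm (of_real (h k z) * f z) \<le> norm (f z)" for k by simp
      qed (use int lim in \<open>auto intro!: tendsto_intros\<close>)
      then have "(\<lambda>k. 0) \<longlonglongrightarrow> (LINT z|circle_measure. of_real (indicator C z) * f z)"
        by (simp add: fourier_null_continuous[OF f hc])
      then have "(LINT z|circle_measure. of_real (indicator C z) * f z) = 0"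
        by (simp add: LIMSEQ_const_iff)
      then show ?thesis by (simp add: set_lebesgue_integral_def scaleR_conv_of_real)
    qed (simp add: set_lebesgue_integral_def)
  next
    case empty
    show ?case by (simp add: set_lebesgue_integral_def)
  next
    case (compl A)
    have [measurable]: "A \<in> sets borel" using compl(1) by (simp add: borel_eq_closed)
    have "(LINT z:UNIV - A|circle_measure. f z) + (LINT z:A|circle_measure. f z) =
        (LINT z:(UNIV - A) \<union> A|circle_measure. f z)"
      by (rule set_integral_Un[symmetric]) (auto intro!: sint)
    also have "\<dots> = 0" by (simp add: full set_lebesgue_integral_def)
    finally show ?case using compl(2) by simp
  next
    case (union A)
    have A: "A i \<in> sets borel" for i using union(2) by (auto simp: borel_eq_closed)
    have "(LINT z:(\<Union>i. A i)|circle_measure. f z) = (\<Sum>i. LINT z:A i|circle_measure. f z)"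
      by (rule lebesgue_integral_countable_add)
        (use A union(1) in \<open>auto simp: disjoint_family_on_def intro!: sint\<close>)
    then show ?case using union(3) by simp
  qed
qed

text \<open>Integrating over \<open>{Re (c f) > 0}\<close> gives \<open>Re (c f) \<le> 0\<close> almost everywhere; the values
  \<open>c = 1, -1, i, -i\<close> leave only \<open>f = 0\<close>.\<close>

lemma fourier_null_AE_zero:
  assumes f: "fourier_null f"
  shows "AE z in circle_measure. f z = 0"
proof -
  have int: "integrable circle_measure f" using f by (simp add: fourier_null_def)
  have [measurable]: "f \<in> borel_measurable circle_measure" using int by auto
  have half: "AE z in circle_measure. Re (c * f z) \<le> 0" for c
  proof -
    define A where "A = {z. 0 < Re (c * f z)}"
    have [measurable]: "A \<in> sets borel"
    proof -
      have "{z \<in> space circle_measure. 0 < Re (c * f z)} \<in> sets circle_measure" by measurable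
      then show ?thesis by (simp add: A_def)
    qed
    have sint: "integrable circle_measure (\<lambda>z. indicator A z *\<^sub>R f z)"
      using int by (intro integrable_mult_indicator) auto
    have int_A: "integrable circle_measure (\<lambda>z. Re (c * (indicator A z *\<^sub>R f z)))"
      using sint by (intro integrable_Re integrable_mult_right)
    have "(LINT z|circle_measure. Re (c * (indicator A z *\<^sub>R f z))) =
        Re (LINT z|circle_measure. c * (indicator A z *\<^sub>R f z))"
      using sint by (intro integral_Re integrable_mult_right)
    also have "\<dots> = Re (c * (LINT z:A|circle_measure. f z))"
      unfolding set_lebesgue_integral_def by (simp only: integral_mult_right_zero)
    also have "\<dots> = 0" by (simp add: fourier_null_set_integral[OF f])
    finally have "AE z in circle_measure. Re (c * (indicator A z *\<^sub>R f z)) = 0"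
      by (subst integral_nonneg_eq_0_iff_AE[symmetric, OF int_A]) (auto simp: A_def indicator_def)
    then show ?thesis
      by eventually_elim (auto simp: A_def indicator_def split: if_splits)
  qed
  show ?thesis
    using half[of 1] half[of "-1"] half[of \<i>] half[of "-\<i>"]
    by eventually_elim (auto simp: complex_eq_iff)
qed

lemma fourier_coeff_zero_imp_zero:
  assumes "\<And>n. cinner f (zpow n) = 0"
  shows "f = 0"
proof -
  have "(LINT z|circle_measure. rep_L2 f z * z powi n) = 0" for n
    using assms[of "- n"] unfolding fourier_coeff_cinner[symmetric] fourier_coeff.rep_eq by simp
  then have "fourier_null (rep_L2 f)"
    by (simp add: fourier_null_def square_integrable_imp_integrable square_integrable_rep_L2)
  then have "AE z in circle_measure. rep_L2 f z = 0" by (rule fourier_null_AE_zero)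
  then have "abs_L2 (rep_L2 f) = abs_L2 (\<lambda>_. 0)"
    by (intro abs_L2_eqI square_integrable_rep_L2 square_integrable_zero)
  then show ?thesis by (simp add: zero_L2_def)
qed

lemma has_sum_zpow: "((\<lambda>n. cinner f (zpow n) *\<^sub>C zpow n) has_sum f) UNIV"
proof -
  obtain g where g: "((\<lambda>n. cinner f (zpow n) *\<^sub>C zpow n) has_sum g) UNIV"
    and "\<And>n. cinner (f - g) (zpow n) = 0"
    using orthonormal_decomposition[OF orthonormal_zpow[of UNIV], of f] by auto
  then have "f - g = 0" by (intro fourier_coeff_zero_imp_zero)
  with g show ?thesis by simp
qed

lemma has_sum_zpow_subset:
  assumes "\<And>n. n \<notin> I \<Longrightarrow> cinner f (zpow n) = 0"
  shows "((\<lambda>n. cinner f (zpow n) *\<^sub>C zpow n) has_sum f) I"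
  using has_sum_zpow[of f]
  by (subst has_sum_cong_neutral[where T = UNIV and g = "\<lambda>n. cinner f (zpow n) *\<^sub>C zpow n"])
    (use assms in auto)


section \<open>Trace duality and subspaces cut out by rank-two functionals\<close>

lemma bounded_opsD:
  assumes "T \<in> bounded_ops H K"
  shows "x \<in> H \<Longrightarrow> T x \<in> K" "x \<in> H \<Longrightarrow> y \<in> H \<Longrightarrow> T (x + y) = T x + T y"
    "x \<in> H \<Longrightarrow> T (c *\<^sub>C x) = c *\<^sub>C T x"
  using assms by (auto simp: bounded_ops_def)

lemma bounded_ops_bound:
  assumes "T \<in> bounded_ops H K"
  obtains C where "0 \<le> C" "\<And>x. x \<in> H \<Longrightarrow> norm (T x) \<le> C * norm x"
proof -
  have "\<exists>C. \<forall>x\<in>H. norm (T x) \<le> C * norm x"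
    using assms by (simp add: bounded_ops_def)
  then obtain C where C: "\<And>x. x \<in> H \<Longrightarrow> norm (T x) \<le> C * norm x"
    by blast
  show thesis
  proof (rule that[of "\<bar>C\<bar>"])
    fix x assume "x \<in> H"
    have "C * norm x \<le> \<bar>C\<bar> * norm x" by (intro mult_right_mono) auto
    with C[OF \<open>x \<in> H\<close>] show "norm (T x) \<le> \<bar>C\<bar> * norm x" by linarith
  qed simp
qed

lemma bounded_ops_zero:
  assumes "complex_subspace H" "T \<in> bounded_ops H K"
  shows "T 0 = 0"
  using bounded_opsD(3)[OF assms(2), of 0 0] assms(1) by (simp add: complex_subspace_def)

lemma bounded_ops_sum:
  assumes H: "complex_subspace H" and T: "T \<in> bounded_ops H K" and x: "\<And>i. i \<in> F \<Longrightarrow> x i \<in> H"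
  shows "T (\<Sum>i\<in>F. c i *\<^sub>C x i) = (\<Sum>i\<in>F. c i *\<^sub>C T (x i))"
  using x
proof (induction F rule: infinite_finite_induct)
  case (insert j F)
  have "c j *\<^sub>C x j \<in> H" "(\<Sum>i\<in>F. c i *\<^sub>C x i) \<in> H"
    using H insert.prems by (auto intro!: complex_subspace_sum simp: complex_subspace_def)
  with insert show ?case by (simp add: bounded_opsD[OF T])
qed (simp_all add: bounded_ops_zero[OF H T])

lemma bounded_ops_has_sum:
  assumes H: "complex_subspace H" and T: "T \<in> bounded_ops H K" and x: "\<And>i. i \<in> I \<Longrightarrow> x i \<in> H"
    and f: "f \<in> H" and sum: "((\<lambda>i. c i *\<^sub>C x i) has_sum f) I"
  shows "((\<lambda>i. c i *\<^sub>C T (x i)) has_sum T f) I"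
proof -
  obtain C where C: "0 \<le> C" "\<And>x. x \<in> H \<Longrightarrow> norm (T x) \<le> C * norm x"
    using bounded_ops_bound[OF T] by blast
  let ?s = "\<lambda>F. \<Sum>i\<in>F. c i *\<^sub>C x i"
  have "((\<lambda>F. C * norm (?s F - f)) \<longlongrightarrow> C * norm (f - f)) (finite_subsets_at_top I)"
    using sum unfolding has_sum_def by (intro tendsto_intros) auto
  then have "((\<lambda>F. C * norm (?s F - f)) \<longlongrightarrow> 0) (finite_subsets_at_top I)" by simp
  moreover have "eventually (\<lambda>F. norm ((\<Sum>i\<in>F. c i *\<^sub>C T (x i)) - T f) \<le> C * norm (?s F - f))
      (finite_subsets_at_top I)"
  proof (rule eventually_finite_subsets_at_top_weakI)
    fix F assume F: "finite F" "F \<subseteq> I"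
    have s: "?s F \<in> H" using F x by (auto intro!: complex_subspace_sum[OF H])
    have "- f \<in> H" by (rule complex_subspace_minus[OF H f])
    moreover have "T (- f) = - T f"
      using bounded_opsD(3)[OF T f, of "-1"] by (simp add: scaleC_minus_one)
    ultimately have d: "?s F - f \<in> H" "T (?s F - f) = T (?s F) - T f"
      using bounded_opsD(2)[OF T s, of "- f"] s H by (auto simp: complex_subspace_def)
    have "T (?s F) = (\<Sum>i\<in>F. c i *\<^sub>C T (x i))"
      using F x by (intro bounded_ops_sum[OF H T]) auto
    then show "norm ((\<Sum>i\<in>F. c i *\<^sub>C T (x i)) - T f) \<le> C * norm (?s F - f)"
      using C(2)[OF d(1)] d(2) by simp
  qed
  ultimately have "((\<lambda>F. (\<Sum>i\<in>F. c i *\<^sub>C T (x i)) - T f) \<longlongrightarrow> 0) (finite_subsets_at_top I)"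
    by (rule Lim_null_comparison[rotated])
  then show ?thesis
    unfolding has_sum_def by (rule LIM_zero_cancel)
qed

text \<open>The left-hand side is \<open>\<Sum>i. \<bar>\<langle>x\<^sub>i, T\<^sup>*y\<rangle>\<bar>\<^sup>2\<close> for the adjoint \<open>T\<^sup>*\<close>, whose norm is at most \<open>C\<close>.\<close>

lemma bounded_ops_Bessel:
  assumes H: "complex_subspace H" and T: "T \<in> bounded_ops H K"
    and C: "0 \<le> C" "\<And>x. x \<in> H \<Longrightarrow> norm (T x) \<le> C * norm x"
    and x: "orthonormal I x" "x ` I \<subseteq> H" and F: "finite F" "F \<subseteq> I"
  shows "(\<Sum>i\<in>F. (norm (cinner (T (x i)) y))\<^sup>2) \<le> (C * norm y)\<^sup>2"
proof (rule functional_Bessel[OF x(1) F])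
  fix c :: "'c \<Rightarrow> complex"
  let ?s = "\<Sum>i\<in>F. c i *\<^sub>C x i"
  have xH: "x i \<in> H" if "i \<in> F" for i using that x(2) F(2) by auto
  have "norm (\<Sum>i\<in>F. c i * cinner (T (x i)) y) = norm (cinner (T ?s) y)"
    by (simp add: bounded_ops_sum[OF H T xH] cinner_sum_left cinner_scaleC_left)
  also have "\<dots> \<le> norm (T ?s) * norm y" by (rule cinner_Cauchy_Schwarz)
  also have "\<dots> \<le> (C * norm ?s) * norm y"
    by (intro mult_right_mono C complex_subspace_sum[OF H] xH) auto
  finally show "norm (\<Sum>i\<in>F. c i * cinner (T (x i)) y) \<le> C * norm y * norm ?s"
    by (simp add: mult_ac)
qed (use C in auto)

text \<open>The trace of \<open>t \<circ> T\<close> computed in an orthonormal basis does not mention a representation of \<open>t\<close>.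
  Expanding each \<open>f n\<close> in the basis turns \<open>\<Sum>n. \<langle>T f\<^sub>n, g\<^sub>n\<rangle>\<close> into a double series, which is absolutely
  convergent by the two Bessel inequalities; exchanging the summations gives that trace.\<close>

lemma nuclear_rep_trace:
  fixes x :: "'i \<Rightarrow> 'a::complex_inner"
  assumes H: "complex_subspace H" and basis: "orthonormal_basis I x H"
    and T: "T \<in> bounded_ops H K" and t: "nuclear_rep K H t f g"
  shows "(\<lambda>n. cinner (T (f n)) (g n)) sums (\<Sum>\<^sub>\<infinity>j\<in>I. cinner (t (T (x j))) (x j))"
proof -
  have x: "orthonormal I x" "x ` I \<subseteq> H" using basis by (auto simp: orthonormal_basis_def)
  have fH: "f n \<in> H" for n using t by (auto simp: nuclear_rep_def)
  obtain C where C: "0 \<le> C" "\<And>x. x \<in> H \<Longrightarrow> norm (T x) \<le> C * norm x"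
    using bounded_ops_bound[OF T] by blast
  define a where "a n j = cinner (f n) (x j) * cinner (T (x j)) (g n)" for n j
  have row: "((\<lambda>j. a n j) has_sum cinner (T (f n)) (g n)) I" for n
  proof -
    have "((\<lambda>j. cinner (f n) (x j) *\<^sub>C x j) has_sum f n) I"
      using basis fH by (auto simp: orthonormal_basis_def)
    then have "((\<lambda>j. cinner (f n) (x j) *\<^sub>C T (x j)) has_sum T (f n)) I"
      using x fH by (intro bounded_ops_has_sum[OF H T]) auto
    then show ?thesis unfolding a_def by (rule has_sum_cinner_left)
  qed
  have column: "(\<lambda>n. a n j) sums cinner (t (T (x j))) (x j)" if "j \<in> I" for j
  proof -
    have "T (x j) \<in> K" using that x bounded_opsD(1)[OF T] by auto
    then have "(\<lambda>n. cinner (T (x j)) (g n) *\<^sub>C f n) sums t (T (x j))"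
      using t by (auto simp: nuclear_rep_def)
    from bounded_linear.sums[OF bounded_linear_cinner_left this, of "x j"]
    show ?thesis by (simp add: a_def cinner_scaleC_left mult.commute)
  qed
  have sf: "summable (\<lambda>n. (norm (f n))\<^sup>2)" and sg: "summable (\<lambda>n. (norm (g n))\<^sup>2)"
    using t by (auto simp: nuclear_rep_def)
  define B where "B = (\<Sum>n. (norm (f n))\<^sup>2 + C\<^sup>2 * (norm (g n))\<^sup>2)"
  have sB: "summable (\<lambda>n. (norm (f n))\<^sup>2 + C\<^sup>2 * (norm (g n))\<^sup>2)"
    by (intro summable_add summable_mult sf sg)
  have bound: "(\<Sum>p\<in>F. norm (case p of (n, j) \<Rightarrow> a n j)) \<le> B" if F: "finite F" "F \<subseteq> UNIV \<times> I" for F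
  proof -
    let ?N = "fst ` F" and ?J = "snd ` F"
    have sub: "F \<subseteq> ?N \<times> ?J" by (rule subset_fst_snd)
    have J: "finite ?J" "?J \<subseteq> I" using F by auto
    have "(\<Sum>p\<in>F. norm (case p of (n, j) \<Rightarrow> a n j)) \<le>
        (\<Sum>p\<in>?N \<times> ?J. norm (case p of (n, j) \<Rightarrow> a n j))"
      using F(1) sub by (intro sum_mono2) auto
    also have "\<dots> = (\<Sum>n\<in>?N. \<Sum>j\<in>?J. norm (a n j))"
      by (subst sum.cartesian_product) (simp add: case_prod_unfold)
    also have "\<dots> \<le> (\<Sum>n\<in>?N. (norm (f n))\<^sup>2 + C\<^sup>2 * (norm (g n))\<^sup>2)"
    proof (rule sum_mono)
      fix n
      have "norm (a n j) \<le> (norm (cinner (f n) (x j)))\<^sup>2 + (norm (cinner (T (x j)) (g n)))\<^sup>2" for j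
      proof -
        let ?u = "norm (cinner (f n) (x j))" and ?v = "norm (cinner (T (x j)) (g n))"
        have "2 * (?u * ?v) \<le> ?u\<^sup>2 + ?v\<^sup>2" using sum_squares_bound[of ?u ?v] by simp
        moreover have "0 \<le> ?u * ?v" by simp
        ultimately show ?thesis unfolding a_def norm_mult by linarith
      qed
      then have "(\<Sum>j\<in>?J. norm (a n j)) \<le>
          (\<Sum>j\<in>?J. (norm (cinner (f n) (x j)))\<^sup>2) + (\<Sum>j\<in>?J. (norm (cinner (T (x j)) (g n)))\<^sup>2)"
        unfolding sum.distrib[symmetric] by (rule sum_mono)
      also have "\<dots> \<le> (norm (f n))\<^sup>2 + (C * norm (g n))\<^sup>2"
        by (intro add_mono Bessel_inequality[OF x(1) J] bounded_ops_Bessel[OF H T C x J])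
      finally show "(\<Sum>j\<in>?J. norm (a n j)) \<le> (norm (f n))\<^sup>2 + C\<^sup>2 * (norm (g n))\<^sup>2"
        by (simp add: power_mult_distrib)
    qed
    also have "\<dots> \<le> B"
      unfolding B_def using F(1) by (intro sum_le_suminf sB) auto
    finally show ?thesis .
  qed
  have "(\<lambda>p. norm (case p of (n, j) \<Rightarrow> a n j)) summable_on UNIV \<times> I"
    by (rule bounded_sums_imp_summable_on[OF _ bound]) simp_all
  then have abs: "(\<lambda>p. norm ((\<lambda>(n, j). a n j) p)) summable_on UNIV \<times> I"
    by (simp add: case_prod_unfold)
  then have summ: "(\<lambda>(n, j). a n j) summable_on UNIV \<times> I"
    by (rule abs_summable_summable)
  have swap: "(\<Sum>\<^sub>\<infinity>n. \<Sum>\<^sub>\<infinity>j\<in>I. a n j) = (\<Sum>\<^sub>\<infinity>j\<in>I. \<Sum>\<^sub>\<infinity>n. a n j)"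
    by (rule infsum_swap_banach[OF summ])
  have "(\<lambda>n. \<Sum>\<^sub>\<infinity>j\<in>I. a n j) summable_on UNIV"
    by (rule summable_on_Sigma_banach[OF summ])
  then have "((\<lambda>n. \<Sum>\<^sub>\<infinity>j\<in>I. a n j) has_sum (\<Sum>\<^sub>\<infinity>n. \<Sum>\<^sub>\<infinity>j\<in>I. a n j)) UNIV"
    by (rule has_sum_infsum)
  from has_sum_imp_sums[OF this]
  have "(\<lambda>n. cinner (T (f n)) (g n)) sums (\<Sum>\<^sub>\<infinity>n. \<Sum>\<^sub>\<infinity>j\<in>I. a n j)"
    by (simp add: infsumI[OF row])
  also have "(\<Sum>\<^sub>\<infinity>n. \<Sum>\<^sub>\<infinity>j\<in>I. a n j) = (\<Sum>\<^sub>\<infinity>j\<in>I. cinner (t (T (x j))) (x j))"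
    unfolding swap
  proof (rule infsum_cong)
    fix j assume j: "j \<in> I"
    have "(\<lambda>p. norm ((\<lambda>(j, n). a n j) p)) summable_on I \<times> UNIV"
      using iffD1[OF summable_on_swap abs] by (simp add: case_prod_unfold)
    then have "(\<lambda>n. norm ((\<lambda>(j, n). a n j) (j, n))) summable_on UNIV"
      using j unfolding Infinite_Sum.abs_summable_on_Sigma_iff by blast
    then have "(\<lambda>n. norm (a n j)) summable_on UNIV" by simp
    then have "((\<lambda>n. a n j) has_sum (\<Sum>\<^sub>\<infinity>n. a n j)) UNIV"
      by (rule has_sum_infsum[OF abs_summable_summable])
    from has_sum_imp_sums[OF this] column[OF j] show "(\<Sum>\<^sub>\<infinity>n. a n j) = cinner (t (T (x j))) (x j)"
      by (rule sums_unique2)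
  qed
  finally show ?thesis .
qed

lemma pairing_eqI:
  assumes H: "complex_subspace H" and basis: "orthonormal_basis I x H"
    and T: "T \<in> bounded_ops H K" and t: "nuclear_rep K H t f g"
    and c: "(\<lambda>n. cinner (T (f n)) (g n)) sums c"
  shows "pairing H K T t = c"
  unfolding pairing_def
proof (rule the_equality)
  show "\<exists>f g. nuclear_rep K H t f g \<and> (\<lambda>n. cinner (T (f n)) (g n)) sums c"
    using t c by blast
  fix d assume "\<exists>f g. nuclear_rep K H t f g \<and> (\<lambda>n. cinner (T (f n)) (g n)) sums d"
  then show "d = c"
    using nuclear_rep_trace[OF H basis T] t c by (metis sums_unique2)
qed

definition rank_two :: "'b::complex_inner set \<Rightarrow> 'a::complex_inner \<Rightarrow> 'b \<Rightarrow> 'a \<Rightarrow> 'b \<Rightarrow> 'b \<Rightarrow> 'a" where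
  "rank_two K f1 g1 f2 g2 = (\<lambda>x\<in>K. cinner x g1 *\<^sub>C f1 - cinner x g2 *\<^sub>C f2)"

lemma nuclear_rep_rank_two:
  assumes H: "complex_subspace H" and K: "complex_subspace K"
    and "f1 \<in> H" "f2 \<in> H" "g1 \<in> K" "g2 \<in> K"
  shows "nuclear_rep K H (rank_two K f1 g1 f2 g2)
    (\<lambda>n. if n = 0 then f1 else if n = 1 then - f2 else 0)
    (\<lambda>n. if n = 0 then g1 else if n = 1 then g2 else 0)" (is "nuclear_rep K H ?t ?f ?g")
proof -
  have fin: "u sums (u 0 + u 1)" if "\<And>n. 1 < n \<Longrightarrow> u n = 0" for u :: "nat \<Rightarrow> 'c::real_normed_vector"
  proof -
    have "u sums (\<Sum>n\<in>{0, 1}. u n)" by (rule sums_finite) (use that in auto)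
    then show ?thesis by simp
  qed
  have "summable (\<lambda>n. (norm (?f n))\<^sup>2)" "summable (\<lambda>n. (norm (?g n))\<^sup>2)"
    by (rule sums_summable[OF fin], simp)+
  moreover have "(\<lambda>n. cinner x (?g n) *\<^sub>C ?f n) sums ?t x" if "x \<in> K" for x
    using fin[of "\<lambda>n. cinner x (?g n) *\<^sub>C ?f n"] that by (simp add: rank_two_def complex_vector.scale_minus_right)
  moreover have "?t \<in> K \<rightarrow>\<^sub>E H"
  proof -
    have "a *\<^sub>C f1 - b *\<^sub>C f2 \<in> H" for a b
      using H assms(3,4) complex_subspace_minus[OF H, of "b *\<^sub>C f2"]
      by (auto simp: complex_subspace_def diff_conv_add_uminus simp del: add_uminus_conv_diff)
    then show ?thesis by (auto simp: rank_two_def)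
  qed
  ultimately show ?thesis
    using assms complex_subspace_minus[OF H, of f2]
    unfolding nuclear_rep_def by (auto simp: complex_subspace_def)
qed

lemma rank_two_finite_rank:
  assumes "complex_subspace H" "complex_subspace K" "f1 \<in> H" "f2 \<in> H" "g1 \<in> K" "g2 \<in> K"
  shows "rank_two K f1 g1 f2 g2 \<in> finite_rank 2 K H"
proof -
  have "rank_two K f1 g1 f2 g2 ` K \<subseteq> complex_vector.span {f1, f2}"
  proof -
    have "f1 \<in> complex_vector.span {f1, f2}" "f2 \<in> complex_vector.span {f1, f2}"
      by (simp_all add: complex_vector.span_base)
    then show ?thesis
      by (auto simp: rank_two_def
          intro: complex_vector.span_diff complex_vector.span_scale)
  qed
  moreover have "finite {f1, f2}" "card {f1, f2} \<le> 2" by (auto simp: card_insert_if)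
  moreover have "rank_two K f1 g1 f2 g2 \<in> trace_class K H"
    using nuclear_rep_rank_two[OF assms] by (auto simp: trace_class_def)
  ultimately show ?thesis unfolding finite_rank_def by blast
qed

lemma pairing_rank_two:
  assumes H: "complex_subspace H" and K: "complex_subspace K" and basis: "orthonormal_basis I x H"
    and T: "T \<in> bounded_ops H K"
    and v: "f1 \<in> H" "f2 \<in> H" "g1 \<in> K" "g2 \<in> K"
  shows "pairing H K T (rank_two K f1 g1 f2 g2) = cinner (T f1) g1 - cinner (T f2) g2"
proof (rule pairing_eqI[OF H basis T nuclear_rep_rank_two[OF H K v]])
  let ?u = "\<lambda>n. cinner (T (if n = 0 then f1 else if n = 1 then - f2 else 0))
      (if n = (0::nat) then g1 else if n = 1 then g2 else 0)"
  have "T (- f2) = - T f2"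
    using bounded_opsD(3)[OF T v(2), of "-1"] by (simp add: scaleC_minus_one)
  moreover have "?u sums (\<Sum>n\<in>{0, 1}. ?u n)"
    by (rule sums_finite) auto
  ultimately show "?u sums (cinner (T f1) g1 - cinner (T f2) g2)"
    by (simp add: cinner_minus_left)
qed

lemma continuous_map_pullback_eval:
  assumes "i \<in> J"
  shows "continuous_map (pullback_topology A (\<lambda>T. \<lambda>i\<in>J. v T i) (product_topology (\<lambda>_. euclidean) J))
    euclidean (\<lambda>T. v T i)"
proof -
  have "continuous_map (pullback_topology A (\<lambda>T. \<lambda>i\<in>J. v T i) (product_topology (\<lambda>_. euclidean) J))
      euclidean ((\<lambda>p. p i) \<circ> (\<lambda>T. \<lambda>i\<in>J. v T i))"
    by (rule continuous_map_pullback) (use assms in \<open>intro continuous_map_product_projection\<close>)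
  then show ?thesis using assms by (simp add: o_def)
qed

lemma topspace_weak_star_topology: "topspace (weak_star_topology H K) = bounded_ops H K"
  and topspace_weak_operator_topology: "topspace (weak_operator_topology H K) = bounded_ops H K"
  unfolding weak_star_topology_def weak_operator_topology_def topspace_pullback_topology by auto

lemma closedin_Collect_Ball:
  assumes "\<And>r. r \<in> R \<Longrightarrow> closedin X {T \<in> topspace X. P r T}"
  shows "closedin X {T \<in> topspace X. \<forall>r\<in>R. P r T}"
proof -
  have "closedin X (\<Inter>(insert (topspace X) ((\<lambda>r. {T \<in> topspace X. P r T}) ` R)))"
    by (rule closedin_Inter) (use assms in auto)
  moreover have "\<Inter>(insert (topspace X) ((\<lambda>r. {T \<in> topspace X. P r T}) ` R)) =
      {T \<in> topspace X. \<forall>r\<in>R. P r T}" by auto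
  ultimately show ?thesis by simp
qed

lemma closedin_annihilator:
  assumes "M \<subseteq> trace_class K H"
  shows "closedin (weak_star_topology H K) (annihilator H K M)"
proof -
  have "closedin (weak_star_topology H K)
      {T \<in> topspace (weak_star_topology H K). \<forall>t\<in>M. pairing H K T t = 0}"
  proof (rule closedin_Collect_Ball)
    fix t assume "t \<in> M"
    then have "continuous_map (weak_star_topology H K) euclidean (\<lambda>T. pairing H K T t)"
      unfolding weak_star_topology_def using assms by (intro continuous_map_pullback_eval) auto
    from closedin_continuous_map_preimage[OF this, of "{0}"]
    show "closedin (weak_star_topology H K)
        {T \<in> topspace (weak_star_topology H K). pairing H K T t = 0}" by simp
  qed
  then show ?thesis by (simp add: topspace_weak_star_topology annihilator_def)
qed

text \<open>Equations \<open>\<langle>T f\<^sub>1, g\<^sub>1\<rangle> = \<langle>T f\<^sub>2, g\<^sub>2\<rangle>\<close> say that \<open>T\<close> annihilates the operator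
  \<open>f\<^sub>1 \<otimes> g\<^sub>1 - f\<^sub>2 \<otimes> g\<^sub>2\<close> of rank at most two. A set of operators described by such equations is therefore
  the annihilator of operators of rank at most two, and it is closed in both topologies.\<close>

lemma reflexive_if_rank_two_equations:
  assumes H: "complex_subspace H" and K: "complex_subspace K" and basis: "orthonormal_basis I x H"
    and R: "\<And>f1 g1 f2 g2. (f1, g1, f2, g2) \<in> R \<Longrightarrow> f1 \<in> H \<and> g1 \<in> K \<and> f2 \<in> H \<and> g2 \<in> K"
    and S: "S = {T \<in> bounded_ops H K. \<forall>(f1, g1, f2, g2)\<in>R. cinner (T f1) g1 = cinner (T f2) g2}"
  shows "closedin (weak_star_topology H K) S \<and> closedin (weak_operator_topology H K) S \<and>
    k_reflexive 2 H K S"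
proof -
  let ?M = "preannihilator H K S \<inter> finite_rank 2 K H"
  have reflexive: "S = annihilator H K ?M"
  proof
    show "S \<subseteq> annihilator H K ?M"
      using S by (auto simp: annihilator_def preannihilator_def)
    show "annihilator H K ?M \<subseteq> S"
    proof
      fix T assume T: "T \<in> annihilator H K ?M"
      then have TB: "T \<in> bounded_ops H K" by (simp add: annihilator_def)
      have "cinner (T f1) g1 = cinner (T f2) g2" if r: "(f1, g1, f2, g2) \<in> R" for f1 g1 f2 g2
      proof -
        have v: "f1 \<in> H" "f2 \<in> H" "g1 \<in> K" "g2 \<in> K" using R[OF r] by auto
        let ?t = "rank_two K f1 g1 f2 g2"
        have t: "?t \<in> finite_rank 2 K H" by (rule rank_two_finite_rank[OF H K v])
        moreover have "pairing H K U ?t = 0" if "U \<in> S" for U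
          using that r pairing_rank_two[OF H K basis _ v, of U] unfolding S by auto
        ultimately have "?t \<in> ?M" by (auto simp: preannihilator_def finite_rank_def)
        then have "pairing H K T ?t = 0" using T by (auto simp: annihilator_def)
        then show ?thesis using pairing_rank_two[OF H K basis TB v] by simp
      qed
      then show "T \<in> S" using TB unfolding S by auto
    qed
  qed
  have ws: "closedin (weak_star_topology H K) S"
    by (subst reflexive) (auto intro!: closedin_annihilator simp: preannihilator_def)
  have wot: "closedin (weak_operator_topology H K) S"
  proof -
    let ?X = "weak_operator_topology H K"
    have cont: "continuous_map ?X euclidean (\<lambda>T. cinner (T f) g)" if "f \<in> H" "g \<in> K" for f g
      using continuous_map_pullback_eval[of "(f, g)" "H \<times> K" "bounded_ops H K"
          "\<lambda>T. \<lambda>(x, y). cinner (T x) y"] that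
      by (simp add: weak_operator_topology_def)
    have "closedin ?X {T \<in> topspace ?X. \<forall>r\<in>R. case r of (f1, g1, f2, g2) \<Rightarrow>
        cinner (T f1) g1 = cinner (T f2) g2}"
    proof (rule closedin_Collect_Ball)
      fix r assume "r \<in> R"
      moreover obtain f1 g1 f2 g2 where r: "r = (f1, g1, f2, g2)" by (cases r) auto
      ultimately have v: "f1 \<in> H" "f2 \<in> H" "g1 \<in> K" "g2 \<in> K" using R by auto
      have "continuous_map ?X euclidean (\<lambda>T. cinner (T f1) g1 - cinner (T f2) g2)"
        by (intro continuous_map_diff cont v)
      from closedin_continuous_map_preimage[OF this, of "{0}"]
      show "closedin ?X {T \<in> topspace ?X. case r of (f1, g1, f2, g2) \<Rightarrow>
          cinner (T f1) g1 = cinner (T f2) g2}" by (simp add: r)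
    qed
    then show ?thesis by (simp add: topspace_weak_operator_topology S)
  qed
  have "op_subspace H K S"
    unfolding op_subspace_def
  proof (intro conjI ballI allI)
    show "S \<subseteq> bounded_ops H K" using S by auto
    have z: "(\<lambda>x\<in>H. 0) \<in> bounded_ops H K"
      using H K by (auto simp: bounded_ops_def complex_subspace_def intro!: exI[of _ 0])
    show "(\<lambda>x\<in>H. 0) \<in> S"
      unfolding S using z R by fastforce
  next
    fix T U assume TU: "T \<in> S" "U \<in> S"
    then have T: "T \<in> bounded_ops H K" and U: "U \<in> bounded_ops H K" using S by auto
    obtain C where C: "\<And>x. x \<in> H \<Longrightarrow> norm (T x) \<le> C * norm x" using bounded_ops_bound[OF T] by blast
    obtain D where D: "\<And>x. x \<in> H \<Longrightarrow> norm (U x) \<le> D * norm x" using bounded_ops_bound[OF U] by blast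
    have "norm (T x + U x) \<le> (C + D) * norm x" if "x \<in> H" for x
      using C[OF that] D[OF that] norm_triangle_ineq[of "T x" "U x"] by (simp add: distrib_right)
    then have "(\<lambda>x\<in>H. T x + U x) \<in> bounded_ops H K"
      using H K bounded_opsD[OF T] bounded_opsD[OF U]
      unfolding bounded_ops_def complex_subspace_def
      by (auto simp: scaleC_add_right add_ac)
    then show "(\<lambda>x\<in>H. T x + U x) \<in> S"
      using TU R unfolding S by (fastforce simp: cinner_add_left)
  next
    fix c T assume TS: "T \<in> S"
    then have T: "T \<in> bounded_ops H K" using S by auto
    obtain C where C: "\<And>x. x \<in> H \<Longrightarrow> norm (T x) \<le> C * norm x" using bounded_ops_bound[OF T] by blast
    have "\<forall>x\<in>H. norm (c *\<^sub>C T x) \<le> (norm c * C) * norm x"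
      using mult_left_mono[OF C, of _ "norm c"] by (simp add: norm_scaleC mult.assoc)
    then have "\<exists>D. \<forall>x\<in>H. norm (c *\<^sub>C T x) \<le> D * norm x" by blast
    moreover have "c *\<^sub>C d *\<^sub>C y = d *\<^sub>C c *\<^sub>C y" for d and y :: 'b
      unfolding scaleC_scaleC by (simp only: mult.commute)
    ultimately have "(\<lambda>x\<in>H. c *\<^sub>C T x) \<in> bounded_ops H K"
      using H K bounded_opsD[OF T]
      unfolding bounded_ops_def complex_subspace_def by (auto simp: scaleC_add_right)
    then show "(\<lambda>x\<in>H. c *\<^sub>C T x) \<in> S"
      using TS R unfolding S by (fastforce simp: cinner_scaleC_left)
  qed
  then show ?thesis using ws wot reflexive by (simp add: k_reflexive_def)
qed


section \<open>Products with bounded functions and the symbol form\<close>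

lemma Linf_iff: "f \<in> Linf \<longleftrightarrow> (\<exists>C. AE z in circle_measure. norm (rep_L2 f z) \<le> C)"
  by (simp add: Linf_def ess_bounded.rep_eq)

lemma square_integrable_mult_bounded:
  assumes u: "square_integrable u" and [measurable]: "v \<in> borel_measurable circle_measure"
    and v: "AE z in circle_measure. norm (v z) \<le> C"
  shows "square_integrable (\<lambda>z. u z * v z)"
  unfolding square_integrable_def
proof
  have [measurable]: "u \<in> borel_measurable circle_measure" using u by (simp add: square_integrable_def)
  show "(\<lambda>z. u z * v z) \<in> borel_measurable circle_measure" by measurable
  show "integrable circle_measure (\<lambda>z. (norm (u z * v z))\<^sup>2)"
  proof (rule Bochner_Integration.integrable_bound)
    show "integrable circle_measure (\<lambda>z. C\<^sup>2 * (norm (u z))\<^sup>2)"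
      using u by (simp add: square_integrable_def)
    show "AE z in circle_measure. norm ((norm (u z * v z))\<^sup>2) \<le> norm (C\<^sup>2 * (norm (u z))\<^sup>2)"
      using v
    proof eventually_elim
      case (elim z)
      then have "(norm (v z))\<^sup>2 \<le> C\<^sup>2" by (intro power_mono) auto
      then have "(norm (v z))\<^sup>2 * (norm (u z))\<^sup>2 \<le> C\<^sup>2 * (norm (u z))\<^sup>2" by (rule mult_right_mono) simp
      then show ?case by (simp add: norm_mult power_mult_distrib mult.commute)
    qed
  qed measurable
qed

lemma rep_mult_L2:
  assumes "square_integrable (\<lambda>z. rep_L2 f z * rep_L2 g z)"
  shows "AE z in circle_measure. rep_L2 (mult_L2 f g) z = rep_L2 f z * rep_L2 g z"
proof -
  have "mult_L2 f g = abs_L2 (\<lambda>z. rep_L2 f z * rep_L2 g z)"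
    using mult_L2.abs_eq[of "rep_L2 f" "rep_L2 g"] assms by (simp add: square_integrable_rep_L2)
  then show ?thesis using rep_abs_L2[OF assms] by simp
qed

lemma rep_mult_L2_right:
  assumes "g \<in> Linf"
  shows "AE z in circle_measure. rep_L2 (mult_L2 f g) z = rep_L2 f z * rep_L2 g z"
proof -
  obtain C where "AE z in circle_measure. norm (rep_L2 g z) \<le> C" using assms by (auto simp: Linf_iff)
  then show ?thesis
    by (intro rep_mult_L2 square_integrable_mult_bounded[OF square_integrable_rep_L2]) auto
qed

lemma rep_mult_L2_left:
  assumes "f \<in> Linf"
  shows "AE z in circle_measure. rep_L2 (mult_L2 f g) z = rep_L2 f z * rep_L2 g z"
proof -
  obtain C where "AE z in circle_measure. norm (rep_L2 f z) \<le> C" using assms by (auto simp: Linf_iff)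
  then have "square_integrable (\<lambda>z. rep_L2 g z * rep_L2 f z)"
    by (intro square_integrable_mult_bounded[OF square_integrable_rep_L2]) auto
  then show ?thesis by (intro rep_mult_L2) (simp add: mult.commute)
qed

lemma zpow_Linf: "zpow n \<in> Linf"
  unfolding Linf_iff
proof
  show "AE z in circle_measure. norm (rep_L2 (zpow n) z) \<le> 1"
    using rep_zpow[of n] AE_circle_norm by eventually_elim (simp add: norm_powi_unit)
qed

text \<open>The value \<open>\<integral> \<phi> f (cnj g)\<close>. It is the inner product of \<open>\<phi> f\<close> with \<open>g\<close> when \<open>f\<close> is bounded, but it is also
  meaningful when instead \<open>g\<close> is bounded; this symmetry is what makes unbounded symbols harmless.\<close>

definition symbol_form :: "L2 \<Rightarrow> L2 \<Rightarrow> L2 \<Rightarrow> complex" where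
  "symbol_form \<phi> f g = (LINT z|circle_measure. rep_L2 \<phi> z * rep_L2 f z * cnj (rep_L2 g z))"

lemma symbol_form_mult_L2:
  assumes "f \<in> Linf \<or> \<phi> \<in> Linf"
  shows "cinner (mult_L2 \<phi> f) g = symbol_form \<phi> f g"
  unfolding symbol_form_def
  by (rule cinner_L2_integral_AE) (use assms in \<open>auto intro: rep_mult_L2_left rep_mult_L2_right\<close>)

lemma symbol_form_adjoint:
  assumes "g \<in> Linf \<or> \<phi> \<in> Linf"
  obtains h where "\<And>f. symbol_form \<phi> f g = cinner f h"
proof -
  have cnj_si: "square_integrable (\<lambda>z. cnj (rep_L2 \<phi> z))"
    using square_integrable_rep_L2[of \<phi>] by (auto simp: square_integrable_def)
  have si: "square_integrable (\<lambda>z. cnj (rep_L2 \<phi> z) * rep_L2 g z)"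
    using assms
  proof
    assume "g \<in> Linf"
    then show ?thesis unfolding Linf_iff
      by (auto intro: square_integrable_mult_bounded[OF cnj_si])
  next
    assume "\<phi> \<in> Linf"
    then obtain C where "AE z in circle_measure. norm (cnj (rep_L2 \<phi> z)) \<le> C" by (auto simp: Linf_iff)
    then have "square_integrable (\<lambda>z. rep_L2 g z * cnj (rep_L2 \<phi> z))"
      by (intro square_integrable_mult_bounded[OF square_integrable_rep_L2]) auto
    then show ?thesis by (simp add: mult.commute)
  qed
  show thesis
  proof (rule that)
    fix f
    have "cinner f (abs_L2 (\<lambda>z. cnj (rep_L2 \<phi> z) * rep_L2 g z)) =
        (LINT z|circle_measure. rep_L2 f z * cnj (cnj (rep_L2 \<phi> z) * rep_L2 g z))"
      by (rule cinner_L2_integral_AE) (auto intro: rep_abs_L2[OF si])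
    then show "symbol_form \<phi> f g = cinner f (abs_L2 (\<lambda>z. cnj (rep_L2 \<phi> z) * rep_L2 g z))"
      unfolding symbol_form_def by (simp add: mult_ac)
  qed
qed

lemma symbol_form_cong:
  assumes "AE z in circle_measure. rep_L2 f z * cnj (rep_L2 g z) = rep_L2 f' z * cnj (rep_L2 g' z)"
  shows "symbol_form \<phi> f g = symbol_form \<phi> f' g'"
  unfolding symbol_form_def
proof (rule integral_cong_AE)
  show "AE z in circle_measure. rep_L2 \<phi> z * rep_L2 f z * cnj (rep_L2 g z) =
      rep_L2 \<phi> z * rep_L2 f' z * cnj (rep_L2 g' z)"
    using assms by eventually_elim (simp add: mult.assoc)
qed measurable

text \<open>Agreement of \<open>T\<close> with a symbol on expanding families passes to sums of series. The first
  variable is extended against the bounded functions \<open>y j\<close>, the second against the bounded function \<open>f\<close>;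
  in neither step do \<open>\<phi>\<close>, \<open>f\<close> and \<open>g\<close> have to be multiplied without one of the factors being bounded.\<close>

lemma symbol_form_extend:
  assumes H: "complex_subspace H" and T: "T \<in> bounded_ops H K"
    and x: "\<And>i. i \<in> I \<Longrightarrow> x i \<in> H" and y: "\<And>j. j \<in> J \<Longrightarrow> y j \<in> Linf"
    and eq: "\<And>i j. i \<in> I \<Longrightarrow> j \<in> J \<Longrightarrow> cinner (T (x i)) (y j) = symbol_form \<phi> (x i) (y j)"
    and f: "f \<in> H" "f \<in> Linf" "((\<lambda>i. c i *\<^sub>C x i) has_sum f) I"
    and g: "((\<lambda>j. d j *\<^sub>C y j) has_sum g) J"
  shows "cinner (T f) g = symbol_form \<phi> f g"
proof -
  have step: "cinner (T f) (y j) = symbol_form \<phi> f (y j)" if j: "j \<in> J" for j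
  proof -
    obtain h where h: "\<And>f. symbol_form \<phi> f (y j) = cinner f h"
      using symbol_form_adjoint[of "y j" \<phi>] y[OF j] by blast
    have "((\<lambda>i. c i * cinner (T (x i)) (y j)) has_sum cinner (T f) (y j)) I"
      by (rule has_sum_cinner_left[OF bounded_ops_has_sum[OF H T x f(1,3)]])
    moreover have "((\<lambda>i. c i * cinner (x i) h) has_sum cinner f h) I"
      by (rule has_sum_cinner_left[OF f(3)])
    moreover have "c i * cinner (T (x i)) (y j) = c i * cinner (x i) h" if "i \<in> I" for i
      using eq[OF that j] h by simp
    ultimately show ?thesis
      using h by (metis (no_types, lifting) has_sum_cong has_sum_unique)
  qed
  have "((\<lambda>j. cnj (d j) * cinner (T f) (y j)) has_sum cinner (T f) g) J"
    by (rule has_sum_cinner_right[OF g])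
  moreover have "((\<lambda>j. cnj (d j) * cinner (mult_L2 \<phi> f) (y j)) has_sum cinner (mult_L2 \<phi> f) g) J"
    by (rule has_sum_cinner_right[OF g])
  moreover have "cnj (d j) * cinner (T f) (y j) = cnj (d j) * cinner (mult_L2 \<phi> f) (y j)" if "j \<in> J" for j
    using step[OF that] f(2) by (simp add: symbol_form_mult_L2)
  ultimately have "cinner (T f) g = cinner (mult_L2 \<phi> f) g"
    by (metis (no_types, lifting) has_sum_cong has_sum_unique)
  then show ?thesis using f(2) by (simp add: symbol_form_mult_L2)
qed


section \<open>The complement of a model space\<close>

lemma inner_functionD:
  assumes "inner_function \<theta>"
  shows "\<theta> \<in> H2" "\<theta> \<in> Linf" "AE z in circle_measure. norm (rep_L2 \<theta> z) = 1"
  using assms by (auto simp: inner_function_def unimodular.rep_eq)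

lemma H2_iff: "f \<in> H2 \<longleftrightarrow> (\<forall>n<0. cinner f (zpow n) = 0)"
  by (simp add: H2_def fourier_coeff_cinner)

lemma zpow_H2: "0 \<le> n \<Longrightarrow> zpow n \<in> H2"
  using orthonormal_zpow[of UNIV] by (auto simp: H2_iff orthonormal_def)

text \<open>The decomposition \<open>K\<^sub>\<theta>\<^sup>\<bottom> = \<theta>H\<^sup>2 \<oplus> cnj (zH\<^sup>2)\<close>, written as one basis indexed by \<open>\<int>\<close>.\<close>

definition perp_basis :: "L2 \<Rightarrow> int \<Rightarrow> L2" where
  "perp_basis \<theta> n = (if 0 \<le> n then mult_L2 \<theta> (zpow n) else zpow n)"

lemma rep_perp_basis:
  "AE z in circle_measure. rep_L2 (perp_basis \<theta> n) z = (if 0 \<le> n then rep_L2 \<theta> z else 1) * z powi n"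
proof (cases "0 \<le> n")
  case True
  have "AE z in circle_measure. rep_L2 (mult_L2 \<theta> (zpow n)) z = rep_L2 \<theta> z * rep_L2 (zpow n) z"
    by (rule rep_mult_L2_right[OF zpow_Linf])
  then show ?thesis using rep_zpow[of n] by eventually_elim (simp add: perp_basis_def True)
next
  case False
  then show ?thesis using rep_zpow[of n] by (simp add: perp_basis_def)
qed

lemma perp_basis_Linf:
  assumes "inner_function \<theta>"
  shows "perp_basis \<theta> n \<in> Linf"
  unfolding Linf_iff
proof
  show "AE z in circle_measure. norm (rep_L2 (perp_basis \<theta> n) z) \<le> 1"
    using rep_perp_basis[of \<theta> n] inner_functionD(3)[OF assms] AE_circle_norm
    by eventually_elim (auto simp: norm_mult norm_powi_unit)
qed

lemma orthonormal_perp_basis: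
  assumes \<theta>: "inner_function \<theta>"
  shows "orthonormal UNIV (perp_basis \<theta>)"
proof -
  have zpow: "cinner (zpow i) (zpow j) = (if i = j then 1 else 0)" for i j
    using orthonormal_zpow[of UNIV] by (simp add: orthonormal_def)
  have cinner: "cinner (perp_basis \<theta> i) (perp_basis \<theta> j) =
      (LINT z|circle_measure. ((if 0 \<le> i then rep_L2 \<theta> z else 1) * z powi i) *
        cnj ((if 0 \<le> j then rep_L2 \<theta> z else 1) * z powi j))" for i j
    by (rule cinner_L2_integral_AE[OF rep_perp_basis rep_perp_basis]) measurable
  have mixed: "cinner (perp_basis \<theta> i) (perp_basis \<theta> j) = 0" if "0 \<le> i" "j < 0" for i j
  proof -
    have "cinner (perp_basis \<theta> i) (perp_basis \<theta> j) = (LINT z|circle_measure. rep_L2 \<theta> z * cnj (z powi (j - i)))"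
      unfolding cinner
    proof (rule integral_cong_AE)
      show "AE z in circle_measure. ((if 0 \<le> i then rep_L2 \<theta> z else 1) * z powi i) *
        cnj ((if 0 \<le> j then rep_L2 \<theta> z else 1) * z powi j) = rep_L2 \<theta> z * cnj (z powi (j - i))"
        using AE_circle_norm
      proof eventually_elim
        case (elim z)
        then have "z \<noteq> 0" by auto
        then have "z powi i * z powi (- j) = z powi (- (j - i))"
          by (simp add: power_int_add[symmetric])
        then show ?case
          using that by (simp add: cnj_powi_unit[OF elim] del: complex_cnj_power_int)
      qed
    qed measurable
    also have "\<dots> = cinner \<theta> (zpow (j - i))"
      by (rule cinner_L2_integral_AE[symmetric]) (auto intro: rep_zpow)
    also have "\<dots> = 0"
      using inner_functionD(1)[OF \<theta>] that by (simp add: H2_iff)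
    finally show ?thesis .
  qed
  have same: "cinner (perp_basis \<theta> i) (perp_basis \<theta> j) = cinner (zpow i) (zpow j)" if "0 \<le> i" "0 \<le> j" for i j
  proof -
    have "cinner (perp_basis \<theta> i) (perp_basis \<theta> j) = (LINT z|circle_measure. z powi i * cnj (z powi j))"
      unfolding cinner
    proof (rule integral_cong_AE)
      show "AE z in circle_measure. ((if 0 \<le> i then rep_L2 \<theta> z else 1) * z powi i) *
        cnj ((if 0 \<le> j then rep_L2 \<theta> z else 1) * z powi j) = z powi i * cnj (z powi j)"
        using inner_functionD(3)[OF \<theta>]
      proof eventually_elim
        case (elim z)
        have "rep_L2 \<theta> z * z powi i * cnj (rep_L2 \<theta> z * z powi j) =
            (rep_L2 \<theta> z * cnj (rep_L2 \<theta> z)) * (z powi i * cnj (z powi j))"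
          by (simp only: complex_cnj_mult mult_ac)
        also have "rep_L2 \<theta> z * cnj (rep_L2 \<theta> z) = 1"
          by (simp add: complex_norm_square[symmetric] elim)
        finally show ?case using that by simp
      qed
    qed measurable
    also have "\<dots> = cinner (zpow i) (zpow j)"
      by (rule cinner_L2_integral_AE[symmetric]) (auto intro: rep_zpow)
    finally show ?thesis .
  qed
  have "cinner (perp_basis \<theta> i) (perp_basis \<theta> j) = (if i = j then 1 else 0)" for i j
  proof (cases "0 \<le> i"; cases "0 \<le> j")
    assume "0 \<le> i" "\<not> 0 \<le> j"
    then show ?thesis using mixed[of i j] by auto
  next
    assume "\<not> 0 \<le> i" "0 \<le> j"
    then show ?thesis using mixed[of j i] cinner_commute[of "perp_basis \<theta> i" "perp_basis \<theta> j"] by auto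
  next
    assume "0 \<le> i" "0 \<le> j"
    then show ?thesis by (simp add: same zpow)
  next
    assume "\<not> 0 \<le> i" "\<not> 0 \<le> j"
    then show ?thesis by (simp add: perp_basis_def zpow)
  qed
  then show ?thesis by (simp add: orthonormal_def)
qed

text \<open>Orthogonality to the negative powers of \<open>z\<close> puts \<open>f\<close> into \<open>H\<^sup>2\<close>. Orthogonality to \<open>\<theta>z\<^sup>n\<close> extends to
  \<open>\<theta>H\<^sup>2\<close> because multiplication by \<open>\<theta>\<close> has an adjoint, so that it may be applied to the Fourier series of
  an element of \<open>H\<^sup>2\<close> term by term.\<close>

lemma orthogonal_perp_basis_imp_model_space:
  assumes \<theta>: "inner_function \<theta>" and f: "\<And>n. cinner f (perp_basis \<theta> n) = 0"
  shows "f \<in> model_space \<theta>"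
  unfolding model_space_def
proof
  show "f \<in> H2" unfolding H2_iff
  proof (intro allI impI)
    fix n :: int assume "n < 0"
    then show "cinner f (zpow n) = 0" using f[of n] by (simp add: perp_basis_def)
  qed
  have "cinner f (mult_L2 \<theta> h) = 0" if h: "h \<in> H2" for h
  proof -
    obtain k where k: "\<And>h. symbol_form \<theta> h f = cinner h k"
      using symbol_form_adjoint[of f \<theta>] inner_functionD(2)[OF \<theta>] by blast
    have mult: "cinner (mult_L2 \<theta> h) f = cinner h k" for h
      using inner_functionD(2)[OF \<theta>] by (simp add: symbol_form_mult_L2 k)
    have "((\<lambda>n. cinner h (zpow n) *\<^sub>C zpow n) has_sum h) {0..}"
      using h by (intro has_sum_zpow_subset) (auto simp: H2_iff)
    then have "((\<lambda>n. cinner h (zpow n) * cinner (zpow n) k) has_sum cinner h k) {0..}"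
      by (rule has_sum_cinner_left)
    moreover have "cinner h (zpow n) * cinner (zpow n) k = 0" if "n \<in> {0..}" for n
    proof -
      have "cinner (mult_L2 \<theta> (zpow n)) f = 0"
        using f[of n] that cinner_commute[of "mult_L2 \<theta> (zpow n)" f] by (simp add: perp_basis_def)
      then show ?thesis by (simp add: mult)
    qed
    ultimately have "cinner h k = 0"
      by (metis (no_types, lifting) has_sum_0 has_sum_unique)
    then show ?thesis using cinner_commute[of f "mult_L2 \<theta> h"] by (simp add: mult)
  qed
  then show "f \<in> ortho_complement (mult_L2 \<theta> ` H2)" by (auto simp: ortho_complement_def)
qed

lemma perp_basis_model_perp: "perp_basis \<theta> n \<in> model_perp \<theta>"
  unfolding model_perp_def ortho_complement_def
proof (intro CollectI ballI)
  fix k assume k: "k \<in> model_space \<theta>"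
  have "cinner k (perp_basis \<theta> n) = 0"
    using k zpow_H2[of n] by (auto simp: model_space_def perp_basis_def H2_iff ortho_complement_def)
  then show "cinner (perp_basis \<theta> n) k = 0"
    using cinner_commute[of "perp_basis \<theta> n" k] by simp
qed

lemma complex_subspace_model_perp: "complex_subspace (model_perp \<theta>)"
  unfolding model_perp_def by (rule complex_subspace_ortho_complement)

text \<open>In contrast to the expansion in the basis, this splitting applies to every \<open>f\<close> in \<open>L\<^sup>2\<close>; it shows
  that the projection onto \<open>K\<^sub>\<theta>\<^sup>\<bottom>\<close> exists.\<close>

lemma model_perp_decomposition:
  assumes \<theta>: "inner_function \<theta>"
  obtains g where "((\<lambda>n. cinner f (perp_basis \<theta> n) *\<^sub>C perp_basis \<theta> n) has_sum g) UNIV"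
    "g \<in> model_perp \<theta>" "f - g \<in> model_space \<theta>"
proof -
  obtain g where g: "((\<lambda>n. cinner f (perp_basis \<theta> n) *\<^sub>C perp_basis \<theta> n) has_sum g) UNIV"
    and orth: "\<And>n. cinner (f - g) (perp_basis \<theta> n) = 0"
    using orthonormal_decomposition[OF orthonormal_perp_basis[OF \<theta>], of f] by auto
  have "g \<in> model_perp \<theta>"
    by (rule closed_subspace_has_sum[OF complex_subspace_model_perp _ perp_basis_model_perp g])
      (simp add: model_perp_def closed_ortho_complement)
  with g orthogonal_perp_basis_imp_model_space[OF \<theta> orth] that show thesis by blast
qed

lemma orthonormal_basis_model_perp:
  assumes \<theta>: "inner_function \<theta>"
  shows "orthonormal_basis UNIV (perp_basis \<theta>) (model_perp \<theta>)"
  unfolding orthonormal_basis_def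
proof (intro conjI ballI)
  show "orthonormal UNIV (perp_basis \<theta>)" by (rule orthonormal_perp_basis[OF \<theta>])
  show "range (perp_basis \<theta>) \<subseteq> model_perp \<theta>" using perp_basis_model_perp by auto
  fix f assume f: "f \<in> model_perp \<theta>"
  obtain g where g: "((\<lambda>n. cinner f (perp_basis \<theta> n) *\<^sub>C perp_basis \<theta> n) has_sum g) UNIV"
    "g \<in> model_perp \<theta>" "f - g \<in> model_space \<theta>"
    using model_perp_decomposition[OF \<theta>, of f] by blast
  have "cinner f (f - g) = 0" "cinner g (f - g) = 0"
    using f g(2,3) unfolding model_perp_def ortho_complement_def by blast+
  then have "cinner (f - g) (f - g) = 0" by (simp add: cinner_diff_left)
  then have "f = g" by (simp add: cinner_self)
  with g(1) show "((\<lambda>n. cinner f (perp_basis \<theta> n) *\<^sub>C perp_basis \<theta> n) has_sum f) UNIV" by simp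
qed

lemma ortho_proj_eqI:
  assumes M: "complex_subspace M" and y: "y \<in> M" "x - y \<in> ortho_complement M"
  shows "ortho_proj M x = y"
  unfolding ortho_proj_def
proof (rule the_equality)
  fix w assume w: "w \<in> M \<and> x - w \<in> ortho_complement M"
  have d: "w - y \<in> M"
    using M w y complex_subspace_minus[OF M y(1)]
    by (auto simp: complex_subspace_def diff_conv_add_uminus simp del: add_uminus_conv_diff)
  have "cinner (x - y) (w - y) = 0" "cinner (x - w) (w - y) = 0"
    using d w y unfolding ortho_complement_def by blast+
  then have "cinner (w - y) (w - y) = 0" by (simp add: cinner_diff_left)
  then show "w = y" by (simp add: cinner_self)
qed (use y in simp)

lemma ortho_proj_model_perp:
  assumes \<theta>: "inner_function \<theta>" and g: "g \<in> model_perp \<theta>"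
  shows "cinner (ortho_proj (model_perp \<theta>) f) g = cinner f g"
proof -
  obtain h where h: "h \<in> model_perp \<theta>" "f - h \<in> model_space \<theta>"
    using model_perp_decomposition[OF \<theta>, of f] by blast
  have orth: "cinner (f - h) y = 0" if "y \<in> model_perp \<theta>" for y
  proof -
    have "cinner y (f - h) = 0"
      using that h(2) unfolding model_perp_def ortho_complement_def by blast
    then show ?thesis using cinner_commute[of "f - h" y] by simp
  qed
  then have "ortho_proj (model_perp \<theta>) f = h"
    by (intro ortho_proj_eqI complex_subspace_model_perp h(1)) (simp add: ortho_complement_def)
  then show ?thesis using orth[OF g] by (simp add: cinner_diff_left)
qed

text \<open>Testing against \<open>g\<close> in \<open>K\<^sub>\<alpha>\<^sup>\<bottom>\<close> removes the projection from the definition of the operator with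
  symbol \<open>\<phi>\<close>.\<close>

lemma dual_TTOs_iff_symbol_form:
  assumes \<alpha>: "inner_function \<alpha>" and T: "T \<in> bounded_ops (model_perp \<theta>) (model_perp \<alpha>)"
  shows "T \<in> dual_TTOs \<theta> \<alpha> \<longleftrightarrow>
    (\<exists>\<phi>. \<forall>f\<in>model_perp \<theta> \<inter> Linf. \<forall>g\<in>model_perp \<alpha>. cinner (T f) g = symbol_form \<phi> f g)"
proof -
  have "T f = dual_TTO \<alpha> \<phi> f \<longleftrightarrow> (\<forall>g\<in>model_perp \<alpha>. cinner (T f) g = symbol_form \<phi> f g)"
    if f: "f \<in> model_perp \<theta> \<inter> Linf" for f \<phi>
  proof
    assume "T f = dual_TTO \<alpha> \<phi> f"
    then show "\<forall>g\<in>model_perp \<alpha>. cinner (T f) g = symbol_form \<phi> f g"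
      using f by (simp add: dual_TTO_def ortho_proj_model_perp[OF \<alpha>] symbol_form_mult_L2)
  next
    assume "\<forall>g\<in>model_perp \<alpha>. cinner (T f) g = symbol_form \<phi> f g"
    then have "mult_L2 \<phi> f - T f \<in> ortho_complement (model_perp \<alpha>)"
      using f by (simp add: ortho_complement_def cinner_diff_left symbol_form_mult_L2)
    moreover have "T f \<in> model_perp \<alpha>" using f bounded_opsD(1)[OF T] by blast
    ultimately show "T f = dual_TTO \<alpha> \<phi> f"
      unfolding dual_TTO_def by (intro ortho_proj_eqI[symmetric] complex_subspace_model_perp)
  qed
  then show ?thesis using T by (auto simp: dual_TTOs_def)
qed


section \<open>Recovering the symbol\<close>

text \<open>For an operator with symbol \<open>\<phi>\<close> the number \<open>\<langle>T f, g\<rangle> = \<integral> \<phi> f (cnj g)\<close> depends only on the product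
  \<open>f (cnj g)\<close>. The functions \<open>f\<^sub>1\<close> and \<open>f\<^sub>2\<close> are bounded, so that this formula holds for every \<open>\<phi>\<close> in
  \<open>L\<^sup>2\<close>.\<close>

definition product_equations :: "L2 \<Rightarrow> L2 \<Rightarrow> (L2 \<times> L2 \<times> L2 \<times> L2) set" where
  "product_equations \<theta> \<alpha> = {(f1, g1, f2, g2).
     f1 \<in> model_perp \<theta> \<inter> Linf \<and> g1 \<in> model_perp \<alpha> \<and> f2 \<in> model_perp \<theta> \<inter> Linf \<and> g2 \<in> model_perp \<alpha> \<and>
     (AE z in circle_measure. rep_L2 f1 z * cnj (rep_L2 g1 z) = rep_L2 f2 z * cnj (rep_L2 g2 z))}"

text \<open>The function \<open>cnj (z\<^sup>p\<^sup>+\<^sup>1 u)\<close>; for bounded \<open>u\<close> in \<open>H\<^sup>2\<close> and \<open>p \<ge> 0\<close> it belongs to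
  \<open>cnj (zH\<^sup>2)\<close>.\<close>

definition coanalytic :: "L2 \<Rightarrow> int \<Rightarrow> L2" where
  "coanalytic u p = abs_L2 (\<lambda>z. cnj (rep_L2 u z * z powi (p + 1)))"

lemma
  assumes u: "u \<in> Linf"
  shows rep_coanalytic: "AE z in circle_measure. rep_L2 (coanalytic u p) z = cnj (rep_L2 u z * z powi (p + 1))"
    and coanalytic_Linf: "coanalytic u p \<in> Linf"
proof -
  obtain C where C: "AE z in circle_measure. norm (rep_L2 u z) \<le> C" using u by (auto simp: Linf_iff)
  have bound: "AE z in circle_measure. norm (cnj (rep_L2 u z * z powi (p + 1))) \<le> C"
    using C AE_circle_norm
    by eventually_elim (simp add: norm_mult norm_powi_unit del: complex_cnj_mult complex_cnj_power_int)
  have "square_integrable (\<lambda>z. cnj (rep_L2 u z * z powi (p + 1)))"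
    by (rule square_integrable_bounded[OF _ bound]) measurable
  from rep_abs_L2[OF this]
  show rep: "AE z in circle_measure. rep_L2 (coanalytic u p) z = cnj (rep_L2 u z * z powi (p + 1))"
    unfolding coanalytic_def .
  show "coanalytic u p \<in> Linf"
    unfolding Linf_iff
  proof
    show "AE z in circle_measure. norm (rep_L2 (coanalytic u p) z) \<le> C"
      using rep bound by eventually_elim simp
  qed
qed

lemma has_sum_coanalytic:
  assumes u: "u \<in> Linf" "u \<in> H2" and p: "0 \<le> p"
  shows "((\<lambda>n. cinner (coanalytic u p) (zpow n) *\<^sub>C zpow n) has_sum coanalytic u p) {..<0}"
proof (rule has_sum_zpow_subset)
  fix n :: int assume "n \<notin> {..<0}"
  then have n: "0 \<le> n" by simp
  have "cinner (coanalytic u p) (zpow n) =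
      (LINT z|circle_measure. cnj (rep_L2 u z * z powi (p + 1)) * cnj (z powi n))"
    by (rule cinner_L2_integral_AE[OF rep_coanalytic[OF u(1)] rep_zpow]) measurable
  also have "\<dots> = (LINT z|circle_measure. cnj (rep_L2 u z * cnj (z powi (- (p + 1 + n)))))"
  proof (rule integral_cong_AE)
    show "AE z in circle_measure. cnj (rep_L2 u z * z powi (p + 1)) * cnj (z powi n) =
        cnj (rep_L2 u z * cnj (z powi (- (p + 1 + n))))"
      using AE_circle_norm
    proof eventually_elim
      case (elim z)
      then have "z \<noteq> 0" by auto
      then have "z powi (p + 1) * z powi n = cnj (z powi (- (p + 1 + n)))"
        unfolding cnj_powi_unit[OF elim] by (simp only: power_int_add minus_minus simp_thms)
      then show ?case
        by (metis complex_cnj_mult mult.assoc)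
    qed
  qed measurable
  also have "\<dots> = cnj (LINT z|circle_measure. rep_L2 u z * cnj (z powi (- (p + 1 + n))))"
    by (rule Bochner_Integration.integral_cnj)
  also have "(LINT z|circle_measure. rep_L2 u z * cnj (z powi (- (p + 1 + n)))) = cinner u (zpow (- (p + 1 + n)))"
    by (rule cinner_L2_integral_AE[symmetric]) (auto intro: rep_zpow)
  also have "\<dots> = 0" using u(2) n p by (simp add: H2_iff)
  finally show "cinner (coanalytic u p) (zpow n) = 0" by simp
qed

lemma zpow_model_perp: "n < 0 \<Longrightarrow> zpow n \<in> model_perp \<theta>"
  using perp_basis_model_perp[of \<theta> n] by (simp add: perp_basis_def)

lemma coanalytic_model_perp:
  assumes "u \<in> Linf" "u \<in> H2" "0 \<le> p"
  shows "coanalytic u p \<in> model_perp \<theta>"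
proof (rule closed_subspace_has_sum[OF complex_subspace_model_perp _ _ has_sum_coanalytic[OF assms]])
  show "closed (model_perp \<theta>)" by (simp add: model_perp_def closed_ortho_complement)
qed (simp add: zpow_model_perp)

lemma rep_zpow_mult_cnj:
  "AE z in circle_measure. rep_L2 (zpow n) z * cnj (rep_L2 (zpow m) z) = z powi (n - m)"
  using rep_zpow[of n] rep_zpow[of m] AE_circle_norm
proof eventually_elim
  case (elim z)
  then have "z \<noteq> 0" by auto
  then show ?case
    by (simp add: elim cnj_powi_unit[OF elim(3)] power_int_add[symmetric] del: complex_cnj_power_int)
qed

lemma zpow_product_equation:
  assumes "n < 0" "m < 0" "n' < 0" "m' < 0" "n - m = n' - m'"
  shows "(zpow n, zpow m, zpow n', zpow m') \<in> product_equations \<theta> \<alpha>"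
  using rep_zpow_mult_cnj[of n m] rep_zpow_mult_cnj[of n' m'] assms
  by (auto simp: product_equations_def zpow_model_perp zpow_Linf elim: eventually_elim2)

text \<open>Every product \<open>x\<^sub>n cnj y\<^sub>m\<close> of basis vectors has the form \<open>h cnj k\<close> with bounded \<open>h\<close>, \<open>k\<close> in \<open>H\<^sup>2\<close>, and
  \<open>h cnj k = cnj (z k) cnj (cnj (z h))\<close>.\<close>

lemma perp_basis_product_equation:
  assumes \<theta>: "inner_function \<theta>" and \<alpha>: "inner_function \<alpha>"
  obtains u v p q where "u \<in> Linf \<inter> H2" "v \<in> Linf \<inter> H2" "0 \<le> p" "0 \<le> q"
    "(perp_basis \<theta> n, perp_basis \<alpha> m, coanalytic v p, coanalytic u q) \<in> product_equations \<theta> \<alpha>"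
proof -
  (* A factor z^n with n < 0 of the first vector equals cnj (z^(-n)) on the circle and is moved into k;
     a factor cnj (z^m) with m < 0 equals z^(-m) and is moved into h. So h = u z^q and k = v z^p. *)
  define u where "u = (if 0 \<le> n then \<theta> else zpow 0)"
  define v where "v = (if 0 \<le> m then \<alpha> else zpow 0)"
  define p where "p = (if 0 \<le> m then m else 0) + (if n < 0 then - n else 0)"
  define q where "q = (if 0 \<le> n then n else 0) + (if m < 0 then - m else 0)"
  have u: "u \<in> Linf" "u \<in> H2" and v: "v \<in> Linf" "v \<in> H2"
    using inner_functionD[OF \<theta>] inner_functionD[OF \<alpha>] zpow_H2[of 0] zpow_Linf[of 0]
    by (auto simp: u_def v_def)
  have pq: "0 \<le> p" "0 \<le> q" "q - p = n - m" by (auto simp: p_def q_def)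
  have "AE z in circle_measure. rep_L2 (perp_basis \<theta> n) z * cnj (rep_L2 (perp_basis \<alpha> m) z) =
      rep_L2 (coanalytic v p) z * cnj (rep_L2 (coanalytic u q) z)"
    using rep_perp_basis[of \<theta> n] rep_perp_basis[of \<alpha> m] rep_coanalytic[OF v(1), of p]
      rep_coanalytic[OF u(1), of q] rep_zpow[of 0] AE_circle_norm
  proof eventually_elim
    case (elim z)
    then have z: "z \<noteq> 0" by auto
    have uv: "(if 0 \<le> n then rep_L2 \<theta> z else 1) = rep_L2 u z" "(if 0 \<le> m then rep_L2 \<alpha> z else 1) = rep_L2 v z"
      using elim(5) by (auto simp: u_def v_def)
    have "z powi n * cnj (z powi m) = z powi (n - m)"
      unfolding cnj_powi_unit[OF elim(6)] using z by (simp add: power_int_add[symmetric])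
    moreover have "cnj (z powi (p + 1)) * z powi (q + 1) = z powi (q - p)"
      unfolding cnj_powi_unit[OF elim(6)] using z by (simp add: power_int_add[symmetric])
    ultimately have powers: "z powi n * cnj (z powi m) = cnj (z powi (p + 1)) * z powi (q + 1)"
      using pq(3) by simp
    have "(rep_L2 u z * z powi n) * cnj (rep_L2 v z * z powi m) =
        rep_L2 u z * cnj (rep_L2 v z) * (z powi n * cnj (z powi m))"
      by (simp only: complex_cnj_mult mult_ac)
    also have "\<dots> = cnj (rep_L2 v z * z powi (p + 1)) * cnj (cnj (rep_L2 u z * z powi (q + 1)))"
      unfolding powers by (simp only: complex_cnj_mult complex_cnj_cnj mult_ac)
    finally show ?case
      unfolding elim(1-4) uv .
  qed
  then have "(perp_basis \<theta> n, perp_basis \<alpha> m, coanalytic v p, coanalytic u q) \<in> product_equations \<theta> \<alpha>"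
    using u v pq
    by (auto simp: product_equations_def perp_basis_model_perp perp_basis_Linf[OF \<theta>] coanalytic_Linf
        coanalytic_model_perp)
  with u v pq show thesis by (intro that[of u v p q]) auto
qed

text \<open>The coefficients of the symbol are read off from the entries of \<open>T\<close> with respect to negative powers of
  \<open>z\<close>: those of nonpositive index from the first column, which is a vector of \<open>L\<^sup>2\<close>, those of positive
  index from the first row, which is square summable by Bessel's inequality for the functional
  \<open>\<langle>T \<cdot>, z\<^sup>-\<^sup>1\<rangle>\<close>. By the Riesz--Fischer theorem the symbol exists in \<open>L\<^sup>2\<close>.\<close>

lemma symbol_exists_negative_powers:
  assumes T: "T \<in> bounded_ops (model_perp \<theta>) (model_perp \<alpha>)"
    and eq: "\<And>f1 g1 f2 g2. (f1, g1, f2, g2) \<in> product_equations \<theta> \<alpha> \<Longrightarrow> cinner (T f1) g1 = cinner (T f2) g2"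
  obtains \<phi> where "\<And>n m. n < 0 \<Longrightarrow> m < 0 \<Longrightarrow> cinner (T (zpow n)) (zpow m) = symbol_form \<phi> (zpow n) (zpow m)"
proof -
  define c where "c k = (if k \<le> 0 then cinner (T (zpow (-1))) (zpow (k - 1))
    else cinner (T (zpow (- k - 1))) (zpow (-1)))" for k
  obtain C where C: "0 \<le> C" "\<And>x. x \<in> model_perp \<theta> \<Longrightarrow> norm (T x) \<le> C * norm x"
    using bounded_ops_bound[OF T] by blast
  have ortho: "orthonormal I (\<lambda>k. zpow (h k))" if "inj h" for I and h :: "int \<Rightarrow> int"
    using orthonormal_zpow[of UNIV] that by (auto simp: orthonormal_def inj_eq)
  have "(\<lambda>k. (norm (c k))\<^sup>2) summable_on {..0}"
  proof (rule bounded_sums_imp_summable_on)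
    fix F :: "int set" assume F: "finite F" "F \<subseteq> {..0}"
    have "(\<Sum>k\<in>F. (norm (c k))\<^sup>2) = (\<Sum>k\<in>F. (norm (cinner (T (zpow (-1))) (zpow (k - 1))))\<^sup>2)"
      using F by (intro sum.cong) (auto simp: c_def)
    also have "\<dots> \<le> (norm (T (zpow (-1))))\<^sup>2"
      by (rule Bessel_inequality[OF ortho F]) (simp add: inj_def)
    finally show "(\<Sum>k\<in>F. (norm (c k))\<^sup>2) \<le> (norm (T (zpow (-1))))\<^sup>2" .
  qed simp
  moreover have "(\<lambda>k. (norm (c k))\<^sup>2) summable_on {0<..}"
  proof (rule bounded_sums_imp_summable_on)
    fix F :: "int set" assume F: "finite F" "F \<subseteq> {0<..}"
    have "(\<Sum>k\<in>F. (norm (c k))\<^sup>2) = (\<Sum>k\<in>F. (norm (cinner (T (zpow (- k - 1))) (zpow (-1))))\<^sup>2)"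
      using F by (intro sum.cong) (auto simp: c_def)
    also have "\<dots> \<le> (C * norm (zpow (-1)))\<^sup>2"
      by (rule bounded_ops_Bessel[OF complex_subspace_model_perp T C ortho _ F])
        (auto simp: inj_def zpow_model_perp)
    finally show "(\<Sum>k\<in>F. (norm (c k))\<^sup>2) \<le> (C * norm (zpow (-1)))\<^sup>2" .
  qed simp
  ultimately have "(\<lambda>k. (norm (c k))\<^sup>2) summable_on ({..0} \<union> {0<..})"
    by (rule summable_on_Un_disjoint) auto
  moreover have "{..0} \<union> {0<..} = (UNIV :: int set)" by auto
  ultimately have "(\<lambda>k. c k *\<^sub>C zpow k) summable_on UNIV"
    by (intro Riesz_Fischer[OF orthonormal_zpow]) simp
  then obtain \<phi> where \<phi>: "((\<lambda>k. c k *\<^sub>C zpow k) has_sum \<phi>) UNIV"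
    by (auto simp: summable_on_def)
  show thesis
  proof (rule that)
    fix n m :: int assume neg: "n < 0" "m < 0"
    have "cinner (T (zpow n)) (zpow m) = c (m - n)"
    proof (cases "m - n \<le> 0")
      case True
      then show ?thesis
        using eq[OF zpow_product_equation[of n m "-1" "m - n - 1"]] neg by (simp add: c_def)
    next
      case False
      then show ?thesis
        using eq[OF zpow_product_equation[of n m "n - m - 1" "-1"]] neg by (simp add: c_def)
    qed
    also have "\<dots> = cinner \<phi> (zpow (m - n))"
      by (rule orthonormal_coefficient[OF orthonormal_zpow \<phi>, symmetric]) simp
    also have "\<dots> = (LINT z|circle_measure. rep_L2 \<phi> z * cnj (z powi (m - n)))"
      by (rule cinner_L2_integral_AE) (auto intro: rep_zpow)
    also have "\<dots> = symbol_form \<phi> (zpow n) (zpow m)"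
      unfolding symbol_form_def
    proof (rule integral_cong_AE)
      show "AE z in circle_measure. rep_L2 \<phi> z * cnj (z powi (m - n)) =
          rep_L2 \<phi> z * rep_L2 (zpow n) z * cnj (rep_L2 (zpow m) z)"
        using rep_zpow_mult_cnj[of n m] AE_circle_norm
        by eventually_elim (simp add: cnj_powi_unit mult.assoc del: complex_cnj_power_int)
    qed measurable
    finally show "cinner (T (zpow n)) (zpow m) = symbol_form \<phi> (zpow n) (zpow m)" .
  qed
qed

text \<open>The symbol found on the negative powers of \<open>z\<close> is the right one on all of \<open>cnj (zH\<^sup>2)\<close>, hence, by
  the product equations, on every pair of basis vectors of \<open>K\<^sub>\<theta>\<^sup>\<bottom>\<close> and \<open>K\<^sub>\<alpha>\<^sup>\<bottom>\<close>. Extending a second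
  time gives all bounded \<open>f\<close> and all \<open>g\<close>.\<close>

lemma symbol_exists:
  assumes \<theta>: "inner_function \<theta>" and \<alpha>: "inner_function \<alpha>"
    and T: "T \<in> bounded_ops (model_perp \<theta>) (model_perp \<alpha>)"
    and eq: "\<And>f1 g1 f2 g2. (f1, g1, f2, g2) \<in> product_equations \<theta> \<alpha> \<Longrightarrow> cinner (T f1) g1 = cinner (T f2) g2"
  obtains \<phi> where "\<And>f g. f \<in> model_perp \<theta> \<inter> Linf \<Longrightarrow> g \<in> model_perp \<alpha> \<Longrightarrow>
    cinner (T f) g = symbol_form \<phi> f g"
proof -
  obtain \<phi> where \<phi>: "\<And>n m. n < 0 \<Longrightarrow> m < 0 \<Longrightarrow>
      cinner (T (zpow n)) (zpow m) = symbol_form \<phi> (zpow n) (zpow m)"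
    using symbol_exists_negative_powers[OF T eq] by blast
  have coanalytic: "cinner (T (coanalytic v p)) (coanalytic u q) =
      symbol_form \<phi> (coanalytic v p) (coanalytic u q)"
    if "u \<in> Linf \<inter> H2" "v \<in> Linf \<inter> H2" "0 \<le> p" "0 \<le> q" for u v p q
    using that
    by (intro symbol_form_extend[OF complex_subspace_model_perp T _ _ _ _ _
          has_sum_coanalytic has_sum_coanalytic])
      (auto simp: zpow_model_perp zpow_Linf \<phi> coanalytic_model_perp coanalytic_Linf)
  have basis: "cinner (T (perp_basis \<theta> n)) (perp_basis \<alpha> m) = symbol_form \<phi> (perp_basis \<theta> n) (perp_basis \<alpha> m)"
    for n m
  proof -
    obtain u v p q where uv: "u \<in> Linf \<inter> H2" "v \<in> Linf \<inter> H2" "0 \<le> p" "0 \<le> q"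
      and r: "(perp_basis \<theta> n, perp_basis \<alpha> m, coanalytic v p, coanalytic u q) \<in> product_equations \<theta> \<alpha>"
      by (rule perp_basis_product_equation[OF \<theta> \<alpha>])
    have "symbol_form \<phi> (perp_basis \<theta> n) (perp_basis \<alpha> m) = symbol_form \<phi> (coanalytic v p) (coanalytic u q)"
      using r by (intro symbol_form_cong) (auto simp: product_equations_def)
    then show ?thesis using eq[OF r] coanalytic[OF uv] by simp
  qed
  show thesis
  proof (rule that)
    fix f g assume f: "f \<in> model_perp \<theta> \<inter> Linf" and g: "g \<in> model_perp \<alpha>"
    show "cinner (T f) g = symbol_form \<phi> f g"
      by (rule symbol_form_extend[OF complex_subspace_model_perp T, where I = UNIV and J = UNIV
            and x = "perp_basis \<theta>" and y = "perp_basis \<alpha>"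
            and c = "\<lambda>n. cinner f (perp_basis \<theta> n)" and d = "\<lambda>n. cinner g (perp_basis \<alpha> n)"])
        (use f g orthonormal_basis_model_perp[OF \<theta>] orthonormal_basis_model_perp[OF \<alpha>] in
          \<open>auto simp: perp_basis_model_perp perp_basis_Linf[OF \<alpha>] basis orthonormal_basis_def\<close>)
  qed
qed

lemma dual_TTOs_eq_product_equations:
  assumes \<theta>: "inner_function \<theta>" and \<alpha>: "inner_function \<alpha>"
  shows "dual_TTOs \<theta> \<alpha> = {T \<in> bounded_ops (model_perp \<theta>) (model_perp \<alpha>).
    \<forall>(f1, g1, f2, g2)\<in>product_equations \<theta> \<alpha>. cinner (T f1) g1 = cinner (T f2) g2}" (is "_ = ?S")
proof
  show "dual_TTOs \<theta> \<alpha> \<subseteq> ?S"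
  proof
    fix T assume T: "T \<in> dual_TTOs \<theta> \<alpha>"
    then have TB: "T \<in> bounded_ops (model_perp \<theta>) (model_perp \<alpha>)" by (simp add: dual_TTOs_def)
    with T obtain \<phi> where \<phi>: "\<And>f g. f \<in> model_perp \<theta> \<inter> Linf \<Longrightarrow> g \<in> model_perp \<alpha> \<Longrightarrow>
        cinner (T f) g = symbol_form \<phi> f g"
      using dual_TTOs_iff_symbol_form[OF \<alpha> TB] by blast
    have "cinner (T f1) g1 = cinner (T f2) g2" if "(f1, g1, f2, g2) \<in> product_equations \<theta> \<alpha>" for f1 g1 f2 g2
      using that symbol_form_cong[of f1 g1 f2 g2 \<phi>] by (auto simp: product_equations_def \<phi>)
    with TB show "T \<in> ?S" by auto
  qed
  show "?S \<subseteq> dual_TTOs \<theta> \<alpha>"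
  proof
    fix T assume T: "T \<in> ?S"
    then have TB: "T \<in> bounded_ops (model_perp \<theta>) (model_perp \<alpha>)" by simp
    obtain \<phi> where "\<And>f g. f \<in> model_perp \<theta> \<inter> Linf \<Longrightarrow> g \<in> model_perp \<alpha> \<Longrightarrow>
        cinner (T f) g = symbol_form \<phi> f g"
      by (rule symbol_exists[OF \<theta> \<alpha> TB]) (use T in auto)
    then show "T \<in> dual_TTOs \<theta> \<alpha>" using dual_TTOs_iff_symbol_form[OF \<alpha> TB] by blast
  qed
qed

theorem theorem5p5:
  fixes \<theta> \<alpha> :: L2
  assumes "inner_function \<theta>" and "nonconstant \<theta>"
    and "inner_function \<alpha>" and "nonconstant \<alpha>"
  shows "closedin (weak_star_topology (model_perp \<theta>) (model_perp \<alpha>)) (dual_TTOs \<theta> \<alpha>)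
    \<and> closedin (weak_operator_topology (model_perp \<theta>) (model_perp \<alpha>)) (dual_TTOs \<theta> \<alpha>)
    \<and> k_reflexive 2 (model_perp \<theta>) (model_perp \<alpha>) (dual_TTOs \<theta> \<alpha>)"
  by (rule reflexive_if_rank_two_equations[OF complex_subspace_model_perp complex_subspace_model_perp
        orthonormal_basis_model_perp[OF assms(1)] _ dual_TTOs_eq_product_equations[OF assms(1,3)]])
    (auto simp: product_equations_def)

end
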